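(* Let $G$ be a stratified group with identity $e$, equipped with a polysmooth layered sup norm $\|\cdot\|$ and the induced left-invariant metric $d(x,y)=\|x^{-1}y\|$. Then every blow-up of the norm $\|\cdot\|$ at any point $p$ of the unit sphere $\partial B=\{p\in G:\|p\|=1\}$, and hence every horofunction $f\in\partial_h(G,d)$, is a piecewise-linear function which depends only on the coordinates of the first layer $V_1$ of the stratification (that is, $f(x)=g(\pi_1(x))$ for a piecewise-linear function $g:V_1\to\mathbb{R}$).
   Context: Stratified group: a simply connected Lie group $G$ whose Lie algebra has a decomposition $\mathfrak g=V_1\oplus\cdots\oplus V_s$ with $[V_1,V_j]=V_{j+1}$ for $1\le j\le s$, $V_s\neq\{0\}$, $V_{s+1}=\{0\}$. $G$ is identified with $\mathfrak g$ through the exponential map (product given by the Baker--Campbell--Hausdorff formula). Dilations: $\delta_t$ ($t>0$) acts on $V_j$ as multiplication by $t^j$. $\pi_j:G\to V_j$ is the projection to the $j$th layer. Layered sup norm: given an ordinary norm $\|\cdot\|_{V_j}$ on each vector space $V_j$, put $\|x\|=\max_{1\le j\le s}\|\pi_j(x)\|_{V_j}^{1/j}$; it is called a layered sup norm when (after rescaling the $\|\cdot\|_{V_j}$ if needed) it satisfies $\|xy\|\le\|x\|+\|y\|$ for all $x,y\in G$. It is polysmooth if each $\|\cdot\|_{V_j}$ is either polyhedral (its unit ball $Q_j$ is a convex centrally symmetric polyhedron) or smooth (continuously differentiable on $V_j\setminus\{0\}$ with strictly convex unit ball). Horofunction boundary: for a metric space $(X,d)$ with base point $x_0$, let $\iota:X\to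 C(X)$, $\iota(x)=d(x,\cdot)-d(x,x_0)$, where $C(X)$ (continuous real functions) has the topology of uniform convergence on compact sets; $\partial_h(X,d)=\overline{\iota(X)}\setminus\iota(X)$, and its elements are called horofunctions. For $G$ the base point is $e$. Blow-up of the norm at $p\in\partial B$: any function $f:G\to\mathbb R$ which is a locally uniform limit $f(x)=\lim_{n\to\infty}\frac{\|p_n\delta_{\epsilon_n}x\|-\|p_n\|}{\epsilon_n}$ for some sequences $p_n\to p$ in $G$ and $\epsilon_n\to0$, $\epsilon_n>0$. Piecewise-linear: continuous, and there is a finite cover of the domain by closed convex polyhedral regions on each of which the function is a linear function plus a constant. *)

theory Defs
  imports "HOL-Analysis.Analysis" "HOL-Algebra.Group"
begin

section \<open>Stratified Lie algebras\<close>

locale real_lie_algebra =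
  fixes bracket :: "'a::euclidean_space \<Rightarrow> 'a \<Rightarrow> 'a"
  assumes bilinear_bracket: "bilinear bracket"
    and alternating: "bracket x x = 0"
    and jacobi: "bracket x (bracket y z) + bracket y (bracket z x) + bracket z (bracket x y) = 0"

text \<open>Only the layers with index \<^term>\<open>1\<close> to \<^term>\<open>Suc s\<close> are meaningful; the values
  of \<^term>\<open>V\<close> at other indices are irrelevant.\<close>

locale stratified_lie_algebra = real_lie_algebra bracket
  for bracket :: "'a::euclidean_space \<Rightarrow> 'a \<Rightarrow> 'a" +
  fixes s :: nat and V :: "nat \<Rightarrow> 'a set"
  assumes step_pos: "1 \<le> s"
    and subspace_layer: "j \<in> {1..s} \<Longrightarrow> subspace (V j)"
    and direct_sum: "\<exists>!v. v \<in> (\<Pi>\<^sub>E j\<in>{1..s}. V j) \<and> x = (\<Sum>j=1..s. v j)"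
    and generating: "j \<in> {1..s} \<Longrightarrow> span {bracket u v |u v. u \<in> V 1 \<and> v \<in> V j} = V (Suc j)"
    and last_layer: "V s \<noteq> {0}"
    and beyond_last_layer: "V (Suc s) = {0}"

definition layer_proj :: "nat \<Rightarrow> (nat \<Rightarrow> 'a::euclidean_space set) \<Rightarrow> nat \<Rightarrow> 'a \<Rightarrow> 'a" where
  "layer_proj s V j x = (THE v. v \<in> (\<Pi>\<^sub>E i\<in>{1..s}. V i) \<and> x = (\<Sum>i=1..s. v i)) j"

definition dilation :: "nat \<Rightarrow> (nat \<Rightarrow> 'a::euclidean_space set) \<Rightarrow> real \<Rightarrow> 'a \<Rightarrow> 'a" where
  "dilation s V t x = (\<Sum>j=1..s. t ^ j *\<^sub>R layer_proj s V j x)"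


section \<open>The Baker--Campbell--Hausdorff product\<close>

text \<open>Right-nested brackets \<open>[w\<^sub>1, [w\<^sub>2, \<dots> [w\<^sub>k\<^sub>-\<^sub>1, w\<^sub>k] \<dots>]]\<close>.\<close>

fun nested_bracket :: "('a \<Rightarrow> 'a \<Rightarrow> 'a) \<Rightarrow> 'a list \<Rightarrow> 'a::zero" where
  "nested_bracket br [] = 0"
| "nested_bracket br [x] = x"
| "nested_bracket br (x # y # ys) = br x (nested_bracket br (y # ys))"

definition bch_indices :: "nat \<Rightarrow> nat \<Rightarrow> (nat \<times> nat) list set" where
  "bch_indices s n = {w. length w = n \<and> (\<forall>(p, q)\<in>set w. 0 < p + q) \<and> (\<Sum>(p, q)\<leftarrow>w. p + q) \<le> s}"

lemma finite_bch_indices [simp]: "finite (bch_indices s n)"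
proof (rule finite_subset)
  show "bch_indices s n \<subseteq> {w. set w \<subseteq> {0..s} \<times> {0..s} \<and> length w = n}"
  proof
    fix w assume w: "w \<in> bch_indices s n"
    have "p \<le> s \<and> q \<le> s" if "(p, q) \<in> set w" for p q
    proof -
      have "p + q \<in> set (map (\<lambda>(p, q). p + q) w)"
        using that by force
      from member_le_sum_list[OF this] show ?thesis
        using w by (auto simp: bch_indices_def)
    qed
    with w show "w \<in> {w. set w \<subseteq> {0..s} \<times> {0..s} \<and> length w = n}"
      by (auto simp: bch_indices_def)
  qed
  show "finite {w. set w \<subseteq> {0..s} \<times> {0..s} \<and> length w = n}"
    by (intro finite_lists_length_eq) auto
qed

text \<open>Dynkin's explicit form of the Baker--Campbell--Hausdorff series
  \<open>log (exp x exp y)\<close>, namely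
  \<open>\<Sum>n\<ge>1. (-1)^(n-1)/n * \<Sum> [x^p\<^sub>1, y^q\<^sub>1, \<dots>, x^p\<^sub>n, y^q\<^sub>n] / ((p\<^sub>1 + q\<^sub>1 + \<dots> + p\<^sub>n + q\<^sub>n) p\<^sub>1! q\<^sub>1! \<dots> p\<^sub>n! q\<^sub>n!)\<close>,
  where all \<open>p\<^sub>i + q\<^sub>i > 0\<close>. In a nilpotent Lie algebra of step \<open>s\<close> all brackets of more than
  \<open>s\<close> elements vanish, so the series is the finite sum of its terms of degree at most \<open>s\<close>.\<close>

definition bch :: "('a::real_vector \<Rightarrow> 'a \<Rightarrow> 'a) \<Rightarrow> nat \<Rightarrow> 'a \<Rightarrow> 'a \<Rightarrow> 'a" where
  "bch br s x y =
    (\<Sum>n=1..s. \<Sum>w\<in>bch_indices s n.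
      ((-1) ^ (n - 1) / (real n * real (\<Sum>(p, q)\<leftarrow>w. p + q) * (\<Prod>(p, q)\<leftarrow>w. fact p * fact q)))
        *\<^sub>R nested_bracket br (concat (map (\<lambda>(p, q). replicate p x @ replicate q y) w)))"


section \<open>Stratified groups\<close>

text \<open>The simply connected Lie group is identified with its Lie algebra through the exponential map,
  so its underlying manifold is the vector space \<^typ>\<open>'a\<close> (with its usual topology).\<close>

locale stratified_group = stratified_lie_algebra bracket s V + group G
  for G :: "'a::euclidean_space monoid" (structure)
    and bracket :: "'a \<Rightarrow> 'a \<Rightarrow> 'a" and s :: nat and V :: "nat \<Rightarrow> 'a set" +
  assumes carrier_eq: "carrier G = UNIV"
    and mult_eq_bch: "x \<otimes> y = bch bracket s x y"


section \<open>Polysmooth layered sup norms\<close>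

definition norm_on_subspace :: "'a::real_vector set \<Rightarrow> ('a \<Rightarrow> real) \<Rightarrow> bool" where
  "norm_on_subspace S N \<longleftrightarrow>
    (\<forall>x\<in>S. 0 \<le> N x) \<and>
    (\<forall>x\<in>S. N x = 0 \<longleftrightarrow> x = 0) \<and>
    (\<forall>x\<in>S. \<forall>c. N (c *\<^sub>R x) = \<bar>c\<bar> * N x) \<and>
    (\<forall>x\<in>S. \<forall>y\<in>S. N (x + y) \<le> N x + N y)"

definition layered_sup ::
    "nat \<Rightarrow> (nat \<Rightarrow> 'a::euclidean_space set) \<Rightarrow> (nat \<Rightarrow> 'a \<Rightarrow> real) \<Rightarrow> 'a \<Rightarrow> real" where
  "layered_sup s V N x = Max ((\<lambda>j. root j (N j (layer_proj s V j x))) ` {1..s})"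

text \<open>Any rescaling that may be needed for the triangle inequality is already incorporated in the
  norms \<^term>\<open>N\<close> on the layers.\<close>

definition layered_sup_norm ::
    "'a::euclidean_space monoid \<Rightarrow> nat \<Rightarrow> (nat \<Rightarrow> 'a set) \<Rightarrow> (nat \<Rightarrow> 'a \<Rightarrow> real) \<Rightarrow> bool" where
  "layered_sup_norm G s V N \<longleftrightarrow>
    (\<forall>j\<in>{1..s}. norm_on_subspace (V j) (N j)) \<and>
    (\<forall>x\<in>carrier G. \<forall>y\<in>carrier G.
      layered_sup s V N (x \<otimes>\<^bsub>G\<^esub> y) \<le> layered_sup s V N x + layered_sup s V N y)"

definition unit_ball_on :: "'a set \<Rightarrow> ('a \<Rightarrow> real) \<Rightarrow> 'a set" where
  "unit_ball_on S N = {x \<in> S. N x \<le> 1}"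

text \<open>Unit balls of norms are always convex and centrally symmetric.\<close>

definition polyhedral_norm_on :: "'a::euclidean_space set \<Rightarrow> ('a \<Rightarrow> real) \<Rightarrow> bool" where
  "polyhedral_norm_on S N \<longleftrightarrow> polyhedron (unit_ball_on S N)"

definition strictly_convex :: "'a::euclidean_space set \<Rightarrow> bool" where
  "strictly_convex Q \<longleftrightarrow> (\<forall>x\<in>Q. \<forall>y\<in>Q. x \<noteq> y \<longrightarrow> open_segment x y \<subseteq> rel_interior Q)"

text \<open>For \<^term>\<open>S\<close> open in a proper subspace the derivative at a point is not unique as a linear
  map on the whole space, but its restriction to the subspace is; since there is a linear projection
  onto the subspace, the definition amounts to continuous differentiability on \<^term>\<open>S\<close> as an open
  subset of that subspace.\<close>

definition continuously_differentiable_on ::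
    "'a::euclidean_space set \<Rightarrow> ('a \<Rightarrow> real) \<Rightarrow> bool" where
  "continuously_differentiable_on S f \<longleftrightarrow>
    (\<exists>D :: 'a \<Rightarrow> 'a \<Rightarrow>\<^sub>L real.
      (\<forall>x\<in>S. (f has_derivative blinfun_apply (D x)) (at x within S)) \<and> continuous_on S D)"

definition smooth_norm_on :: "'a::euclidean_space set \<Rightarrow> ('a \<Rightarrow> real) \<Rightarrow> bool" where
  "smooth_norm_on S N \<longleftrightarrow>
    continuously_differentiable_on (S - {0}) N \<and> strictly_convex (unit_ball_on S N)"

definition polysmooth ::
    "nat \<Rightarrow> (nat \<Rightarrow> 'a::euclidean_space set) \<Rightarrow> (nat \<Rightarrow> 'a \<Rightarrow> real) \<Rightarrow> bool" where
  "polysmooth s V N \<longleftrightarrow>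
    (\<forall>j\<in>{1..s}. polyhedral_norm_on (V j) (N j) \<or> smooth_norm_on (V j) (N j))"

definition left_inv_dist :: "('a, 'b) monoid_scheme \<Rightarrow> ('a \<Rightarrow> real) \<Rightarrow> 'a \<Rightarrow> 'a \<Rightarrow> real" where
  "left_inv_dist G nrm x y = nrm (inv\<^bsub>G\<^esub> x \<otimes>\<^bsub>G\<^esub> y)"


section \<open>Blow-ups\<close>

definition locally_uniform_limit ::
    "(nat \<Rightarrow> 'a::topological_space \<Rightarrow> 'b::metric_space) \<Rightarrow> ('a \<Rightarrow> 'b) \<Rightarrow> bool" where
  "locally_uniform_limit F f \<longleftrightarrow>
    (\<forall>x. \<exists>U. open U \<and> x \<in> U \<and> uniform_limit U F f sequentially)"

definition blow_up ::
    "'a::euclidean_space monoid \<Rightarrow> nat \<Rightarrow> (nat \<Rightarrow> 'a set) \<Rightarrow> ('a \<Rightarrow> real) \<Rightarrow> 'a \<Rightarrow> ('a \<Rightarrow> real) \<Rightarrow> bool"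
  where
  "blow_up G s V nrm p f \<longleftrightarrow>
    (\<exists>P \<epsilon>. P \<longlonglongrightarrow> p \<and> \<epsilon> \<longlonglongrightarrow> 0 \<and> (\<forall>n. 0 < \<epsilon> n) \<and>
      locally_uniform_limit
        (\<lambda>n x. (nrm (P n \<otimes>\<^bsub>G\<^esub> dilation s V (\<epsilon> n) x) - nrm (P n)) / \<epsilon> n) f)"


section \<open>The horofunction boundary of a metric space\<close>

text \<open>Functions on the metric space \<^term>\<open>M\<close> are represented by extensional functions.\<close>

context Metric_space
begin

definition continuous_functions :: "('a \<Rightarrow> real) set" where
  "continuous_functions = {f \<in> extensional M. continuous_map mtopology euclideanreal f}"

definition ucc_open :: "('a \<Rightarrow> real) set \<Rightarrow> bool" where
  "ucc_open U \<longleftrightarrow>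
    U \<subseteq> continuous_functions \<and>
    (\<forall>f\<in>U. \<exists>K \<epsilon>. compactin mtopology K \<and> 0 < \<epsilon> \<and>
      {g \<in> continuous_functions. \<forall>x\<in>K. \<bar>g x - f x\<bar> < \<epsilon>} \<subseteq> U)"

text \<open>The topology of uniform convergence on compact sets.\<close>

definition ucc_topology :: "('a \<Rightarrow> real) topology" where
  "ucc_topology = topology ucc_open"

lemma istopology_ucc_open: "istopology ucc_open"
  unfolding istopology_def
proof (intro conjI allI impI)
  fix S T assume S: "ucc_open S" and T: "ucc_open T"
  show "ucc_open (S \<inter> T)"
    unfolding ucc_open_def
  proof (intro conjI ballI)
    show "S \<inter> T \<subseteq> continuous_functions"
      using S by (auto simp: ucc_open_def)
    fix f assume f: "f \<in> S \<inter> T"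
    obtain K a where K: "compactin mtopology K" "0 < a"
      "{g \<in> continuous_functions. \<forall>x\<in>K. \<bar>g x - f x\<bar> < a} \<subseteq> S"
      using S f unfolding ucc_open_def by blast
    obtain L b where L: "compactin mtopology L" "0 < b"
      "{g \<in> continuous_functions. \<forall>x\<in>L. \<bar>g x - f x\<bar> < b} \<subseteq> T"
      using T f unfolding ucc_open_def by blast
    have "compactin mtopology (K \<union> L)" "0 < min a b"
      using K L by (auto intro: compactin_Un)
    moreover have "{g \<in> continuous_functions. \<forall>x\<in>K \<union> L. \<bar>g x - f x\<bar> < min a b} \<subseteq> S \<inter> T"
      using K(3) L(3) by auto
    ultimately show "\<exists>K \<epsilon>. compactin mtopology K \<and> 0 < \<epsilon> \<and>
      {g \<in> continuous_functions. \<forall>x\<in>K. \<bar>g x - f x\<bar> < \<epsilon>} \<subseteq> S \<inter> T"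
      by blast
  qed
next
  fix \<K> assume "\<forall>K\<in>\<K>. ucc_open K"
  then show "ucc_open (\<Union>\<K>)"
    unfolding ucc_open_def by (meson Sup_least UnionE Union_upper subset_trans)
qed

lemma openin_ucc_topology: "openin ucc_topology U \<longleftrightarrow> ucc_open U"
  by (simp add: ucc_topology_def istopology_ucc_open topology_inverse')

definition horo_embedding :: "'a \<Rightarrow> 'a \<Rightarrow> 'a \<Rightarrow> real" where
  "horo_embedding x\<^sub>0 x = (\<lambda>y\<in>M. d x y - d x x\<^sub>0)"

definition horofunction_boundary :: "'a \<Rightarrow> ('a \<Rightarrow> real) set" where
  "horofunction_boundary x\<^sub>0 =
    (ucc_topology closure_of (horo_embedding x\<^sub>0 ` M)) - horo_embedding x\<^sub>0 ` M"

end


section \<open>Piecewise-linear functions\<close>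

text \<open>Members of \<^const>\<open>polyhedron\<close> are closed and convex.\<close>

definition piecewise_linear_on :: "'a::euclidean_space set \<Rightarrow> ('a \<Rightarrow> real) \<Rightarrow> bool" where
  "piecewise_linear_on S g \<longleftrightarrow>
    continuous_on S g \<and>
    (\<exists>\<P>. finite \<P> \<and> \<Union>\<P> = S \<and>
      (\<forall>P\<in>\<P>. polyhedron P \<and> (\<exists>L c. linear L \<and> (\<forall>x\<in>P. g x = L x + c))))"

end

theory Submission
  imports Defs
begin

text \<open>
  Each layer norm is the maximum of finitely many functions that are strictly differentiable away
  from \<open>0\<close>: the norm itself in the smooth case, the facet functionals in the polyhedral case. Hence
  the layered norm is a maximum of finitely many branches \<open>\<phi>\<^sub>i\<close>. Since
  \<open>p\<^sub>n \<delta>\<^sub>\<epsilon> x = p\<^sub>n + \<epsilon> B (\<pi>\<^sub>1 x) + o(\<epsilon>)\<close> with \<open>B\<close> linear, a branch with \<open>\<phi>\<^sub>i p = 1\<close> contributes a linear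
  function of \<open>\<pi>\<^sub>1 x\<close> plus the offset \<open>(\<phi>\<^sub>i p\<^sub>n - \<parallel>p\<^sub>n\<parallel>) / \<epsilon>\<^sub>n \<le> 0\<close> to the difference quotient, while the
  branches with \<open>\<phi>\<^sub>i p < 1\<close> tend to \<open>-\<infinity>\<close>. After passing to a subsequence along which all offsets
  converge in \<open>[-\<infinity>, 0]\<close>, the limit is a maximum of finitely many affine functions of \<open>\<pi>\<^sub>1 x\<close>.
  A horofunction is a limit of \<open>d x\<^sub>n y - d x\<^sub>n e\<close> with \<open>\<parallel>x\<^sub>n\<parallel>\<close> tending to infinity; rescaling by
  \<open>\<epsilon>\<^sub>n = 1 / \<parallel>x\<^sub>n\<parallel>\<close> turns it into a blow-up at a limit point of \<open>\<delta>\<^sub>\<epsilon>\<^sub>n (x\<^sub>n\<^sup>-\<^sup>1)\<close>.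
\<close>

section \<open>Maxima of finitely many functions\<close>

text \<open>Used to flatten the maximum over layers of the maxima over branches into one finite
  maximum indexed by pairs.\<close>

lemma Max_image_Sigma:
  fixes f :: "'a \<Rightarrow> 'b \<Rightarrow> 'c::linorder"
  assumes "finite I" "I \<noteq> {}" "\<And>i. i \<in> I \<Longrightarrow> finite (A i)" "\<And>i. i \<in> I \<Longrightarrow> A i \<noteq> {}"
  shows "(MAX i\<in>I. MAX a\<in>A i. f i a) = (MAX (i, a)\<in>Sigma I A. f i a)"
proof (rule Max_eqI)
  have fin: "finite (Sigma I A)" "Sigma I A \<noteq> {}"
    using assms by auto
  show "y \<le> (MAX (i, a)\<in>Sigma I A. f i a)" if y: "y \<in> (\<lambda>i. MAX a\<in>A i. f i a) ` I" for y
  proof -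
    obtain i where i: "i \<in> I" "y = (MAX a\<in>A i. f i a)"
      using y by blast
    have "f i a \<le> (MAX (i, a)\<in>Sigma I A. f i a)" if "a \<in> A i" for a
      using fin that i by (intro Max_ge) force+
    then show ?thesis
      using i assms by simp
  qed
  have "(MAX (i, a)\<in>Sigma I A. f i a) \<in> (\<lambda>(i, a). f i a) ` Sigma I A"
    using fin by (intro Max_in) auto
  then obtain i a where ia: "i \<in> I" "a \<in> A i" "(MAX (i, a)\<in>Sigma I A. f i a) = f i a"
    by auto
  have "(MAX (i, a)\<in>Sigma I A. f i a) = (MAX a\<in>A i. f i a)"
  proof (rule antisym)
    show "(MAX (i, a)\<in>Sigma I A. f i a) \<le> (MAX a\<in>A i. f i a)"
      unfolding ia(3) using ia assms by (intro Max_ge) auto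
    have "f i b \<le> (MAX (i, a)\<in>Sigma I A. f i a)" if "b \<in> A i" for b
      using fin that ia by (intro Max_ge) force+
    then show "(MAX a\<in>A i. f i a) \<le> (MAX (i, a)\<in>Sigma I A. f i a)"
      using ia assms by simp
  qed
  then show "(MAX (i, a)\<in>Sigma I A. f i a) \<in> (\<lambda>i. MAX a\<in>A i. f i a) ` I"
    using ia by blast
qed (use assms in simp)

lemma tendsto_Max_image:
  fixes f :: "'i \<Rightarrow> 'a \<Rightarrow> 'b::linorder_topology"
  assumes "finite I" "I \<noteq> {}" "\<And>i. i \<in> I \<Longrightarrow> ((f i) \<longlongrightarrow> l i) F"
  shows "((\<lambda>x. MAX i\<in>I. f i x) \<longlongrightarrow> (MAX i\<in>I. l i)) F"
  using assms
proof (induction rule: finite_ne_induct)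
  case (insert i I)
  then show ?case
    by (auto intro!: tendsto_max)
qed auto

text \<open>The cells are the sets where a given index attains the maximum; each is cut out of
  \<open>S\<close> by finitely many closed half-spaces.\<close>

lemma piecewise_linear_on_Max:
  fixes L :: "'i \<Rightarrow> 'a::euclidean_space \<Rightarrow> real"
  assumes S: "subspace S" and J: "finite J" "J \<noteq> {}" and L: "\<And>i. i \<in> J \<Longrightarrow> linear (L i)"
  shows "piecewise_linear_on S (\<lambda>v. MAX i\<in>J. L i v + b i)"
  unfolding piecewise_linear_on_def
proof (intro conjI exI)
  let ?g = "\<lambda>v. MAX i\<in>J. L i v + b i"
  define R where "R i = S \<inter> \<Inter> ((\<lambda>k. {v. L k v + b k \<le> L i v + b i}) ` J)" for i
  have cont: "continuous_on UNIV (L i)" if "i \<in> J" for i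
    using L[OF that] by (simp add: linear_continuous_on linear_linear)
  have contb: "continuous_on S (\<lambda>v. L i v + b i)" if "i \<in> J" for i
    using continuous_on_subset[OF cont[OF that], of S] by (intro continuous_intros) auto
  show "continuous_on S ?g"
    unfolding continuous_on_def
    by (intro ballI tendsto_Max_image J) (use contb in \<open>auto simp: continuous_on_def\<close>)
  have halfspace: "polyhedron {v. L k v + b k \<le> L i v + b i}" if ki: "k \<in> J" "i \<in> J" for k i
  proof -
    have "linear (\<lambda>v. L k v - L i v)"
      using L ki by (simp add: linear_compose_sub)
    \<comment> \<open>The vector \<open>a\<close> represents the linear functional; it is the
      adjoint applied to \<open>1\<close>.\<close>
    then obtain a where a: "\<And>v. L k v - L i v = a \<bullet> v"
      using adjoint_works[where f = "\<lambda>v. L k v - L i v" and y = 1]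
      by (metis inner_commute inner_real_def mult.right_neutral)
    have "{v. L k v + b k \<le> L i v + b i} = {v. a \<bullet> v \<le> b i - b k}"
      by (auto simp: a[symmetric])
    then show ?thesis
      by (simp add: polyhedron_halfspace_le)
  qed
  have polyhedron_R: "polyhedron (R i)" if "i \<in> J" for i
    unfolding R_def
  proof (intro polyhedron_Int polyhedron_Inter)
    show "polyhedron S"
      using S by (intro affine_imp_polyhedron subspace_imp_affine)
  qed (use halfspace J that in auto)
  have val: "?g v = L i v + b i" if "i \<in> J" "v \<in> R i" for i v
    using that J by (intro Max_eqI) (auto simp: R_def)
  have "S \<subseteq> \<Union>(R ` J)"
  proof
    fix v assume v: "v \<in> S"
    have "?g v \<in> (\<lambda>i. L i v + b i) ` J"
      using J by (intro Max_in) auto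
    then obtain i where i: "i \<in> J" "?g v = L i v + b i"
      by auto
    have "L k v + b k \<le> L i v + b i" if "k \<in> J" for k
      unfolding i(2)[symmetric] using J that by (intro Max_ge) auto
    then show "v \<in> \<Union>(R ` J)"
      using i v by (auto simp: R_def)
  qed
  then show "\<Union>(R ` J) = S"
    by (auto simp: R_def)
  show "finite (R ` J)"
    using J by simp
  show "\<forall>P\<in>R ` J. polyhedron P \<and> (\<exists>L c. linear L \<and> (\<forall>x\<in>P. ?g x = L x + c))"
    using polyhedron_R val L by fastforce
qed

section \<open>Limits of finite maxima along subsequences\<close>

text \<open>Induction on \<open>I\<close>, passing to a further subsequence for each new index. The
  application takes values in \<open>ereal\<close>, so unbounded real sequences are covered as
  well.\<close>

lemma simultaneous_convergent_subseq:
  fixes c :: "'i \<Rightarrow> nat \<Rightarrow> 'a::{complete_linorder, linorder_topology, first_countable_topology}"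
  assumes "finite I"
  shows "\<exists>l r. strict_mono (r :: nat \<Rightarrow> nat) \<and> (\<forall>i\<in>I. (\<lambda>n. c i (r n)) \<longlonglongrightarrow> l i)"
  using assms
proof induction
  case empty
  show ?case
    by (auto intro: strict_mono_id)
next
  case (insert i I)
  then obtain l and r :: "nat \<Rightarrow> nat"
    where r: "strict_mono r" "\<forall>i\<in>I. (\<lambda>n. c i (r n)) \<longlonglongrightarrow> l i"
    by blast
  obtain m and r' :: "nat \<Rightarrow> nat"
    where r': "strict_mono r'" "((\<lambda>n. c i (r n)) \<circ> r') \<longlonglongrightarrow> m"
    using compact_complete_linorder by blast
  have "(\<lambda>n. c k (r (r' n))) \<longlonglongrightarrow> (l(i := m)) k" if "k \<in> insert i I" for k
    using that insert r' r LIMSEQ_subseq_LIMSEQ[of "\<lambda>n. c k (r n)" "l k" r']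
    by (cases "k = i") (auto simp: o_def)
  then show ?case
    using strict_mono_o[OF r(1) r'(1)]
    by (intro exI[of _ "l(i := m)"] exI[of _ "r \<circ> r'"]) (auto simp: o_def simp del: fun_upd_apply)
qed

text \<open>Along a subsequence the offsets \<open>c i n\<close> converge in \<open>[-\<infinity>, 0]\<close>; those tending to
  \<open>-\<infinity>\<close> drop out of the maximum.\<close>

lemma limit_of_Max_affine:
  fixes X :: "'i \<Rightarrow> nat \<Rightarrow> 'a \<Rightarrow> real" and c :: "'i \<Rightarrow> nat \<Rightarrow> real"
  assumes I: "finite I" "I \<noteq> {}" "A \<subseteq> I"
    and lim: "\<And>x. (\<lambda>n. MAX i\<in>I. X i n x) \<longlonglongrightarrow> f x"
    and active: "\<And>i x. i \<in> A \<Longrightarrow> (\<lambda>n. X i n x - c i n) \<longlonglongrightarrow> L i x"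
    and nonpos: "\<And>i n. i \<in> A \<Longrightarrow> c i n \<le> 0"
    and inactive: "\<And>i x. i \<in> I - A \<Longrightarrow> filterlim (\<lambda>n. X i n x) at_bot sequentially"
  shows "\<exists>J b. J \<subseteq> A \<and> J \<noteq> {} \<and> (\<forall>x. f x = (MAX i\<in>J. L i x + b i))"
proof -
  have finA: "finite A"
    using I finite_subset by blast
  obtain l :: "'i \<Rightarrow> ereal" and r :: "nat \<Rightarrow> nat"
    where r: "strict_mono r" and l: "\<And>i. i \<in> A \<Longrightarrow> (\<lambda>n. ereal (c i (r n))) \<longlonglongrightarrow> l i"
    using simultaneous_convergent_subseq[OF finA, of "\<lambda>i n. ereal (c i n)"] by auto
  have l_le: "l i \<le> 0" if "i \<in> A" for i
    using nonpos[OF that] by (intro LIMSEQ_le_const2[OF l[OF that]]) auto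
  define J where "J = {i\<in>A. l i \<noteq> -\<infinity>}"
  have lJ: "l i = ereal (real_of_ereal (l i))" if "i \<in> J" for i
    using that l_le[of i] by (cases "l i") (auto simp: J_def)
  \<comment> \<open>\<open>m i x\<close> is the limit of branch \<open>i\<close> in the extended
    reals: \<open>-\<infinity>\<close> both for an inactive branch and for an active one whose
    offset diverges.\<close>
  define m where "m i x = (if i \<in> J then ereal (L i x + real_of_ereal (l i)) else -\<infinity>)" for i x
  have X: "(\<lambda>n. ereal (X i (r n) x)) \<longlonglongrightarrow> m i x" if i: "i \<in> I" for i x
  proof (cases "i \<in> A")
    case True
    have "(\<lambda>n. ereal (X i (r n) x - c i (r n))) \<longlonglongrightarrow> ereal (L i x)"
      using LIMSEQ_subseq_LIMSEQ[OF active[OF True] r] by (simp add: o_def)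
    \<comment> \<open>The limits may be added because \<open>ereal (L i x)\<close> is
      finite.\<close>
    then have "(\<lambda>n. ereal (X i (r n) x - c i (r n)) + ereal (c i (r n))) \<longlonglongrightarrow> ereal (L i x) + l i"
      using l[OF True] l_le[OF True] by (intro tendsto_add_ereal_general) auto
    moreover have "ereal (L i x) + l i = m i x"
      using lJ[of i] True by (cases "l i") (auto simp: m_def J_def)
    ultimately show ?thesis
      by simp
  next
    case False
    then have "filterlim (\<lambda>n. X i (r n) x) at_bot sequentially"
      using filterlim_compose[OF inactive filterlim_subseq[OF r]] i by blast
    then show ?thesis
      using False by (auto simp: m_def J_def tendsto_MInfty filterlim_at_bot_dense)
  qed
  have fx: "ereal (f x) = (MAX i\<in>I. m i x)" for x
  proof -
    have "(MAX i\<in>I. ereal (X i n x)) = ereal (MAX i\<in>I. X i n x)" for n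
      using I mono_Max_commute[of ereal "(\<lambda>i. X i n x) ` I"]
      by (simp add: mono_def image_image)
    moreover have "(\<lambda>n. MAX i\<in>I. ereal (X i (r n) x)) \<longlonglongrightarrow> (MAX i\<in>I. m i x)"
      by (intro tendsto_Max_image I X)
    ultimately have "(\<lambda>n. ereal (MAX i\<in>I. X i (r n) x)) \<longlonglongrightarrow> (MAX i\<in>I. m i x)"
      by simp
    moreover have "(\<lambda>n. ereal (MAX i\<in>I. X i (r n) x)) \<longlonglongrightarrow> ereal (f x)"
      using LIMSEQ_subseq_LIMSEQ[OF lim r] by (simp add: o_def)
    ultimately show ?thesis
      by (rule LIMSEQ_unique[symmetric])
  qed
  \<comment> \<open>The real number \<open>f x\<close> is not \<open>-\<infinity>\<close>, so an
    index attaining the maximum must lie in \<open>J\<close>; this also shows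
    \<open>J \<noteq> {}\<close>.\<close>
  have attained: "\<exists>i\<in>J. f x = L i x + real_of_ereal (l i)" for x
  proof -
    have "(MAX i\<in>I. m i x) \<in> (\<lambda>i. m i x) ` I"
      using I by (intro Max_in) auto
    then obtain i where "i \<in> I" "ereal (f x) = m i x"
      unfolding fx by blast
    then show ?thesis
      by (auto simp: m_def split: if_splits)
  qed
  have upper: "L i x + real_of_ereal (l i) \<le> f x" if "i \<in> J" for i x
  proof -
    have "m i x \<le> ereal (f x)"
      unfolding fx using I that by (intro Max_ge) (auto simp: J_def)
    then show ?thesis
      using that by (simp add: m_def)
  qed
  have "f x = (MAX i\<in>J. L i x + real_of_ereal (l i))" for x
    using finA upper attained[of x] by (intro Max_eqI[symmetric]) (auto simp: J_def)
  moreover have "J \<noteq> {}"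
    using attained by blast
  ultimately show ?thesis
    by (intro exI[of _ J] exI[of _ "\<lambda>i. real_of_ereal (l i)"]) (auto simp: J_def)
qed

section \<open>Strict derivatives\<close>

text \<open>Base points \<open>q n\<close> and directions \<open>v n\<close> both vary with
  \<open>n\<close>, because the difference quotients of a blow-up start at moving points and their
  rescaled increments merely converge.\<close>

definition strict_derivative_within ::
    "('a::real_normed_vector \<Rightarrow> real) \<Rightarrow> ('a \<Rightarrow> real) \<Rightarrow> 'a set \<Rightarrow> 'a \<Rightarrow> bool" where
  "strict_derivative_within f D S p \<longleftrightarrow>
    (\<forall>q v e w. q \<longlonglongrightarrow> p \<and> v \<longlonglongrightarrow> w \<and> e \<longlonglongrightarrow> 0 \<and> (\<forall>n. 0 < e n) \<and>
      (\<forall>n. q n \<in> S \<and> q n + e n *\<^sub>R v n \<in> S) \<longrightarrow>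
      (\<lambda>n. (f (q n + e n *\<^sub>R v n) - f (q n)) / e n) \<longlonglongrightarrow> D w)"

lemma strict_derivative_withinD:
  assumes "strict_derivative_within f D S p" "q \<longlonglongrightarrow> p" "v \<longlonglongrightarrow> w" "e \<longlonglongrightarrow> 0"
    "\<And>n. 0 < e n" "\<And>n. q n \<in> S" "\<And>n. q n + e n *\<^sub>R v n \<in> S"
  shows "(\<lambda>n. (f (q n + e n *\<^sub>R v n) - f (q n)) / e n) \<longlonglongrightarrow> D w"
  using assms unfolding strict_derivative_within_def by blast

text \<open>The mean value theorem along a segment. The intermediate point stays within
  \<open>e * norm v\<close> of \<open>q\<close>, so it follows \<open>q\<close> as the step
  shrinks.\<close>

lemma mvt_segment:
  fixes f :: "'a::real_normed_vector \<Rightarrow> real"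
  assumes "convex T" "q \<in> T" "q + e *\<^sub>R v \<in> T" "0 < e"
    and f: "\<And>x. x \<in> T \<Longrightarrow> (f has_derivative blinfun_apply (D x)) (at x within T)"
  shows "\<exists>y\<in>T. dist y q \<le> e * norm v \<and> f (q + e *\<^sub>R v) - f q = e * D y v"
proof -
  have in_T: "q + t *\<^sub>R v \<in> T" if "0 \<le> t" "t \<le> e" for t
  proof -
    have "(1 - t / e) *\<^sub>R q + (t / e) *\<^sub>R (q + e *\<^sub>R v) \<in> T"
      using assms that by (intro convexD_alt) auto
    also have "(1 - t / e) *\<^sub>R q + (t / e) *\<^sub>R (q + e *\<^sub>R v) = q + t *\<^sub>R v"
      using assms(4) by (simp add: algebra_simps)
    finally show ?thesis .
  qed
  have "\<exists>t\<in>{0<..<e}. f (q + e *\<^sub>R v) - f (q + 0 *\<^sub>R v) = D (q + t *\<^sub>R v) ((e - 0) *\<^sub>R v)"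
  proof (rule mvt_simple[OF \<open>0 < e\<close>, where f' = "\<lambda>t u. D (q + t *\<^sub>R v) (u *\<^sub>R v)"])
    fix t assume t: "0 \<le> t" "t \<le> e"
    have der: "((\<lambda>t. q + t *\<^sub>R v) has_derivative (\<lambda>u. u *\<^sub>R v)) (at t within {0..e})"
      by (auto intro!: derivative_eq_intros)
    show "((\<lambda>t. f (q + t *\<^sub>R v)) has_derivative (\<lambda>u. D (q + t *\<^sub>R v) (u *\<^sub>R v)))
        (at t within {0..e})"
      using in_T t
      by (intro has_derivative_in_compose2[where t = T and g' = "\<lambda>x. blinfun_apply (D x)", OF f _ _ der])
        auto
  qed
  then obtain t where "t \<in> {0<..<e}" "f (q + e *\<^sub>R v) - f q = e * D (q + t *\<^sub>R v) v"
    by (auto simp: blinfun.scaleR_right)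
  then show ?thesis
    using in_T[of t] by (intro bexI[of _ "q + t *\<^sub>R v"]) (auto simp: dist_norm mult_right_mono)
qed

text \<open>By the mean value theorem the quotient is \<open>D (y n) (v n)\<close> with
  \<open>y n\<close> tending to \<open>p\<close>, and \<open>D\<close> is continuous. Convexity of
  \<open>T\<close> keeps the segments inside the domain of differentiability.\<close>

lemma strict_derivative_within_C1:
  fixes f :: "'a::real_normed_vector \<Rightarrow> real"
  assumes T: "convex T" "p \<in> T" "openin (top_of_set S) T"
    and f: "\<And>x. x \<in> T \<Longrightarrow> (f has_derivative blinfun_apply (D x)) (at x within T)"
    and D: "continuous_on T D"
  shows "strict_derivative_within f (D p) S p"
  unfolding strict_derivative_within_def
proof (intro allI impI, elim conjE)
  fix q v :: "nat \<Rightarrow> 'a" and e :: "nat \<Rightarrow> real" and w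
  assume q: "q \<longlonglongrightarrow> p" and v: "v \<longlonglongrightarrow> w" and e: "e \<longlonglongrightarrow> 0" "\<forall>n. 0 < e n"
    and S: "\<forall>n. q n \<in> S \<and> q n + e n *\<^sub>R v n \<in> S"
  obtain U where U: "open U" "T = S \<inter> U"
    using T(3) by (metis openin_open)
  have "(\<lambda>n. q n + e n *\<^sub>R v n) \<longlonglongrightarrow> p + 0 *\<^sub>R w"
    by (intro tendsto_intros q v e)
  then have "\<forall>\<^sub>F n in sequentially. q n + e n *\<^sub>R v n \<in> U" "\<forall>\<^sub>F n in sequentially. q n \<in> U"
    using U T(2) q by (auto intro: topological_tendstoD)
  \<comment> \<open>\<open>T\<close> is open relative to \<open>S\<close>, so both endpoints
    eventually lie in \<open>T\<close>.\<close>
  then have ev: "\<forall>\<^sub>F n in sequentially. q n \<in> T \<and> q n + e n *\<^sub>R v n \<in> T"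
    using S U by (auto elim: eventually_elim2)
  \<comment> \<open>The implication under the quantifier allows a choice for every \<open>n\<close>,
    including the finitely many with an endpoint outside \<open>T\<close>.\<close>
  have "\<exists>y. q n \<in> T \<and> q n + e n *\<^sub>R v n \<in> T \<longrightarrow>
      y \<in> T \<and> dist y (q n) \<le> e n * norm (v n) \<and> f (q n + e n *\<^sub>R v n) - f (q n) = e n * D y (v n)"
    for n
    using mvt_segment[OF T(1) _ _ _ f, of "q n" "e n" "v n"] e(2) by auto
  then obtain y where y: "\<And>n. q n \<in> T \<Longrightarrow> q n + e n *\<^sub>R v n \<in> T \<Longrightarrow>
      y n \<in> T \<and> dist (y n) (q n) \<le> e n * norm (v n) \<and>
      f (q n + e n *\<^sub>R v n) - f (q n) = e n * D (y n) (v n)"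
    by metis
  have "(\<lambda>n. e n * norm (v n)) \<longlonglongrightarrow> 0 * norm w"
    by (intro tendsto_intros e v)
  then have "(\<lambda>n. y n - q n) \<longlonglongrightarrow> 0"
    by (intro Lim_null_comparison[of "\<lambda>n. y n - q n" "\<lambda>n. e n * norm (v n)"] eventually_mono[OF ev])
      (use y in \<open>auto simp: dist_norm\<close>)
  from tendsto_add[OF q this] have "y \<longlonglongrightarrow> p"
    by simp
  then have "(\<lambda>n. D (y n)) \<longlonglongrightarrow> D p"
    using ev y by (intro continuous_on_tendsto_compose[OF D]) (auto simp: T elim: eventually_mono)
  then have "(\<lambda>n. D (y n) (v n)) \<longlonglongrightarrow> D p w"
    by (intro tendsto_intros v)
  moreover have "\<forall>\<^sub>F n in sequentially. D (y n) (v n) = (f (q n + e n *\<^sub>R v n) - f (q n)) / e n"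
    using ev
  proof eventually_elim
    case (elim n)
    then show ?case
      using y[of n] e(2)[rule_format, of n] by simp
  qed
  ultimately show "(\<lambda>n. (f (q n + e n *\<^sub>R v n) - f (q n)) / e n) \<longlonglongrightarrow> D p w"
    by (rule Lim_transform_eventually)
qed

lemma strict_derivative_within_linear:
  fixes L :: "'a::euclidean_space \<Rightarrow> real"
  assumes "linear L"
  shows "strict_derivative_within L L S p"
  unfolding strict_derivative_within_def
proof (intro allI impI, elim conjE)
  fix q v :: "nat \<Rightarrow> 'a" and e :: "nat \<Rightarrow> real" and w
  assume v: "v \<longlonglongrightarrow> w" and e: "\<forall>n. 0 < e n"
  have "(L (q n + e n *\<^sub>R v n) - L (q n)) / e n = L (v n)" for n
    using e[rule_format, of n] by (simp add: linear_add[OF assms] linear_cmul[OF assms])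
  moreover have "(\<lambda>n. L (v n)) \<longlonglongrightarrow> L w"
    by (rule linear_continuous_at[THEN isCont_tendsto_compose])
      (use v assms in \<open>auto simp: linear_linear\<close>)
  ultimately show "(\<lambda>n. (L (q n + e n *\<^sub>R v n) - L (q n)) / e n) \<longlonglongrightarrow> L w"
    by simp
qed

text \<open>The base point is \<open>1\<close> because a branch active at \<open>p\<close> has the
  value \<open>1\<close> there before the root is taken. The constant \<open>k\<close> is
  \<open>1 / j\<close>.\<close>

lemma strict_derivative_within_root:
  assumes "0 < j"
  shows "\<exists>k. strict_derivative_within (root j) (\<lambda>u. k * u) UNIV 1"
proof -
  define D where "D x = inverse (real j * root j x ^ (j - 1))" for x
  have "strict_derivative_within (root j) (blinfun_mult_right (D 1)) UNIV 1"
  proof (rule strict_derivative_within_C1[where T = "{0<..}"])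
    show "(root j has_derivative blinfun_apply (blinfun_mult_right (D x))) (at x within {0<..})"
      if "x \<in> {0<..}" for x
      using DERIV_real_root[OF assms, of x] that
      by (auto simp: D_def has_field_derivative_def blinfun_mult_right.rep_eq
          intro: has_derivative_at_withinI)
    show "continuous_on {0<..} (\<lambda>x. blinfun_mult_right (D x))"
      unfolding D_def using assms
      by (intro bounded_linear.continuous_on[OF bounded_linear_blinfun_mult_right]
          continuous_intros) auto
  qed auto
  then show ?thesis
    by (auto simp: blinfun_mult_right.rep_eq)
qed

section \<open>Norms on subspaces\<close>

lemma norm_on_subspaceD:
  assumes "norm_on_subspace S N"
  shows norm_on_subspace_nonneg: "x \<in> S \<Longrightarrow> 0 \<le> N x"
    and norm_on_subspace_eq_0: "x \<in> S \<Longrightarrow> N x = 0 \<longleftrightarrow> x = 0"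
    and norm_on_subspace_scaleR: "x \<in> S \<Longrightarrow> N (c *\<^sub>R x) = \<bar>c\<bar> * N x"
    and norm_on_subspace_triangle: "x \<in> S \<Longrightarrow> y \<in> S \<Longrightarrow> N (x + y) \<le> N x + N y"
  using assms unfolding norm_on_subspace_def by auto

text \<open>Composing \<open>N\<close> with a linear projection onto \<open>S\<close> gives a finite
  convex function on the whole space, hence a continuous one.\<close>

lemma continuous_on_norm_on_subspace:
  fixes N :: "'a::euclidean_space \<Rightarrow> real"
  assumes S: "subspace S" and N: "norm_on_subspace S N"
  shows "continuous_on S N"
proof -
  obtain g where g: "range g \<subseteq> S" "linear g" "\<forall>v\<in>S. g (id v) = v"
    using real_vector.linear_exists_left_inverse_on[OF linear_id S] by auto
  have gS: "g x \<in> S" for x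
    using g by auto
  have "convex_on UNIV (\<lambda>x. N (g x))"
  proof (rule convex_onI)
    fix t :: real and x y
    assume t: "0 < t" "t < 1"
    have "N (g ((1 - t) *\<^sub>R x + t *\<^sub>R y)) = N ((1 - t) *\<^sub>R g x + t *\<^sub>R g y)"
      by (simp add: linear_add[OF g(2)] linear_cmul[OF g(2)])
    also have "\<dots> \<le> N ((1 - t) *\<^sub>R g x) + N (t *\<^sub>R g y)"
      using gS S by (intro norm_on_subspace_triangle[OF N] subspace_scale)
    also have "\<dots> = (1 - t) * N (g x) + t * N (g y)"
      using t gS by (simp add: norm_on_subspace_scaleR[OF N])
    finally show "N (g ((1 - t) *\<^sub>R x + t *\<^sub>R y)) \<le> (1 - t) * N (g x) + t * N (g y)" .
  qed auto
  then have "continuous_on UNIV (\<lambda>x. N (g x))"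
    by (intro convex_on_continuous) auto
  from continuous_on_subset[OF this subset_UNIV, of S] show ?thesis
    by (rule continuous_on_eq) (use g(3) in auto)
qed

text \<open>\<open>N\<close> attains a positive minimum on the compact unit sphere of
  \<open>S\<close>, and \<open>C\<close> is its inverse; for the zero subspace the sphere is empty
  and \<open>C = 0\<close> serves.\<close>

lemma norm_on_subspace_coercive:
  fixes N :: "'a::euclidean_space \<Rightarrow> real"
  assumes S: "subspace S" and N: "norm_on_subspace S N"
  shows "\<exists>C\<ge>0. \<forall>x\<in>S. norm x \<le> C * N x"
proof (cases "S \<inter> sphere 0 1 = {}")
  case True
  have "x = 0" if "x \<in> S" for x
  proof (rule ccontr)
    assume "x \<noteq> 0"
    then have "(1 / norm x) *\<^sub>R x \<in> S \<inter> sphere 0 1"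
      using that S by (auto simp: subspace_scale)
    then show False
      using True by blast
  qed
  then show ?thesis
    by (intro exI[of _ 0]) auto
next
  case False
  have "compact (S \<inter> sphere 0 1)"
    using closed_subspace[OF S] by (simp add: compact_Int_closed Int_commute closed_Int_compact)
  then obtain u where u: "u \<in> S \<inter> sphere 0 1" "\<And>y. y \<in> S \<inter> sphere 0 1 \<Longrightarrow> N u \<le> N y"
    using continuous_attains_inf[OF _ False continuous_on_subset[OF continuous_on_norm_on_subspace[OF S N]]]
    by blast
  have pos: "0 < N u"
    using u(1) norm_on_subspace_nonneg[OF N, of u] norm_on_subspace_eq_0[OF N, of u]
    by (cases "u = 0") auto
  have "norm x \<le> (1 / N u) * N x" if x: "x \<in> S" for x
  proof (cases "x = 0")
    case True
    then show ?thesis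
      using norm_on_subspace_nonneg[OF N x] pos by simp
  next
    case False
    then have "N u \<le> N ((1 / norm x) *\<^sub>R x)"
      using x S by (intro u) (auto simp: subspace_scale)
    then show ?thesis
      using pos False x by (simp add: norm_on_subspace_scaleR[OF N] field_simps)
  qed
  then show ?thesis
    using pos by (intro exI[of _ "1 / N u"]) auto
qed

text \<open>The functionals are the normals of the half-spaces cutting out the unit ball, rescaled
  to right-hand side \<open>1\<close>. Normals of half-spaces with right-hand side \<open>0\<close>
  vanish on \<open>S\<close> and are dropped.\<close>

lemma polyhedral_norm_eq_Max:
  fixes N :: "'a::euclidean_space \<Rightarrow> real"
  assumes S: "subspace S" and N: "norm_on_subspace S N" and poly: "polyhedral_norm_on S N"
  shows "\<exists>A. finite A \<and> A \<noteq> {} \<and> (\<forall>v\<in>S. N v = (MAX a\<in>A. a \<bullet> v))"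
proof -
  obtain H where H: "finite H" "unit_ball_on S N = \<Inter>H"
    "\<forall>h\<in>H. \<exists>a b. a \<noteq> 0 \<and> h = {x. a \<bullet> x \<le> b}"
    using poly unfolding polyhedral_norm_on_def polyhedron_def by blast
  obtain a b where ab: "\<And>h. h \<in> H \<Longrightarrow> h = {x. a h \<bullet> x \<le> b h}"
    using H(3) by metis
  have ball: "x \<in> S \<and> N x \<le> 1 \<longleftrightarrow> (\<forall>h\<in>H. a h \<bullet> x \<le> b h)" for x
  proof -
    have "x \<in> unit_ball_on S N \<longleftrightarrow> (\<forall>h\<in>H. x \<in> h)"
      using H(2) by blast
    then show ?thesis
      using ab by (auto simp: unit_ball_on_def)
  qed
  have N0: "N 0 = 0"
    using norm_on_subspace_eq_0[OF N] S subspace_0 by blast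
  have b_nonneg: "0 \<le> b h" if "h \<in> H" for h
    using ball[of 0] N0 S subspace_0 that by auto
  have scaled: "a h \<bullet> x \<le> b h * t" if "x \<in> S" "0 < t" "N x \<le> t" "h \<in> H" for h x t
  proof -
    have "a h \<bullet> ((1 / t) *\<^sub>R x) \<le> b h"
      using ball[of "(1 / t) *\<^sub>R x"] that S
      by (auto simp: subspace_scale norm_on_subspace_scaleR[OF N])
    then show ?thesis
      using that by (simp add: field_simps)
  qed
  have bound: "a h \<bullet> x \<le> b h * N x" if "x \<in> S" "h \<in> H" for h x
  proof (cases "x = 0")
    case False
    then have "0 < N x"
      using norm_on_subspace_nonneg[OF N] norm_on_subspace_eq_0[OF N] that by (metis less_eq_real_def)
    then show ?thesis
      using scaled[of x "N x" h] that by simp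
  qed (use N0 in simp)
  \<comment> \<open>Inserting \<open>0\<close> makes the maximum nonnegative, and keeps
    \<open>A\<close> nonempty if no half-space has a positive right-hand side.\<close>
  define A where "A = insert 0 ((\<lambda>h. (1 / b h) *\<^sub>R a h) ` {h\<in>H. 0 < b h})"
  have A: "finite A" "A \<noteq> {}"
    using H(1) by (auto simp: A_def)
  have "N v = (MAX a\<in>A. a \<bullet> v)" if v: "v \<in> S" for v
  proof (rule antisym)
    show "(MAX a\<in>A. a \<bullet> v) \<le> N v"
      using A bound v norm_on_subspace_nonneg[OF N v] by (auto simp: A_def field_simps)
    show "N v \<le> (MAX a\<in>A. a \<bullet> v)"
    \<comment> \<open>For every \<open>t\<close> above the maximum, \<open>v / t\<close> satisfies
      all the constraints and so lies in the unit ball.\<close>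
    proof (rule dense_ge)
      fix t assume t: "(MAX a\<in>A. a \<bullet> v) < t"
      then have le: "\<forall>a\<in>A. a \<bullet> v < t"
        using A by auto
      then have "0 < t"
        by (auto simp: A_def)
      have "a h \<bullet> ((1 / t) *\<^sub>R v) \<le> b h" if h: "h \<in> H" for h
      proof (cases "b h = 0")
        case True
        then show ?thesis
          using bound[OF v h] \<open>0 < t\<close> by (simp add: field_simps)
      next
        case False
        then have "0 < b h"
          using b_nonneg[OF h] by simp
        then have "(1 / b h) *\<^sub>R a h \<bullet> v < t"
          using le h by (auto simp: A_def)
        then show ?thesis
          using \<open>0 < b h\<close> \<open>0 < t\<close> by (simp add: field_simps)
      qed
      then have "N ((1 / t) *\<^sub>R v) \<le> 1"
        using ball by blast
      then show "N v \<le> t"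
        using \<open>0 < t\<close> v by (simp add: norm_on_subspace_scaleR[OF N] field_simps)
    qed
  qed
  then show ?thesis
    using A by blast
qed

text \<open>A common interface for the polyhedral and the smooth case. Derivatives are demanded away
  from \<open>0\<close> only, as a norm on a nonzero space is not differentiable at
  \<open>0\<close>.\<close>

definition branch_family :: "'a::euclidean_space set \<Rightarrow> ('a \<Rightarrow> real) \<Rightarrow> ('a \<Rightarrow> real) set \<Rightarrow> bool" where
  "branch_family S N \<Phi> \<longleftrightarrow> finite \<Phi> \<and> \<Phi> \<noteq> {} \<and> (\<forall>v\<in>S. N v = (MAX h\<in>\<Phi>. h v)) \<and>
    (\<forall>h\<in>\<Phi>. continuous_on S h \<and>
      (\<forall>u\<in>S - {0}. \<exists>D. linear D \<and> strict_derivative_within h D S u))"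

text \<open>A polyhedral norm has linear functionals as branches, each its own derivative; a smooth
  norm is its own single branch.\<close>

lemma norm_branches:
  fixes N :: "'a::euclidean_space \<Rightarrow> real"
  assumes S: "subspace S" and N: "norm_on_subspace S N"
    and "polyhedral_norm_on S N \<or> smooth_norm_on S N"
  shows "\<exists>\<Phi>. branch_family S N \<Phi>"
  using assms(3)
proof
  assume "polyhedral_norm_on S N"
  then obtain A where A: "finite A" "A \<noteq> {}" "\<forall>v\<in>S. N v = (MAX a\<in>A. a \<bullet> v)"
    using polyhedral_norm_eq_Max[OF S N] by blast
  have lin: "linear ((\<bullet>) a)" for a :: 'a
    by (simp add: bounded_linear.linear bounded_linear_inner_right)
  then show ?thesis
    unfolding branch_family_def using A
    by (intro exI[of _ "(\<bullet>) ` A"])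
      (auto simp: image_image intro!: continuous_intros strict_derivative_within_linear)
next
  assume "smooth_norm_on S N"
  then obtain D :: "'a \<Rightarrow> 'a \<Rightarrow>\<^sub>L real"
    where D: "\<And>x. x \<in> S - {0} \<Longrightarrow> (N has_derivative blinfun_apply (D x)) (at x within S - {0})"
      and contD: "continuous_on (S - {0}) D"
    unfolding smooth_norm_on_def continuously_differentiable_on_def by blast
  have "strict_derivative_within N (D u) S u" if u: "u \<in> S - {0}" for u
  \<comment> \<open>The open ball of radius \<open>norm u\<close> about \<open>u\<close> is a convex
    neighbourhood that avoids the origin.\<close>
  proof (rule strict_derivative_within_C1[where T = "S \<inter> ball u (norm u)"])
    have sub: "S \<inter> ball u (norm u) \<subseteq> S - {0}"
      by auto
    show "(N has_derivative blinfun_apply (D x)) (at x within S \<inter> ball u (norm u))"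
      if "x \<in> S \<inter> ball u (norm u)" for x
      using that sub by (intro has_derivative_subset[OF D sub]) auto
    show "continuous_on (S \<inter> ball u (norm u)) D"
      by (rule continuous_on_subset[OF contD sub])
    show "openin (top_of_set S) (S \<inter> ball u (norm u))"
      by (simp add: openin_open_Int)
    show "convex (S \<inter> ball u (norm u))"
      by (intro convex_Int subspace_imp_convex S convex_ball)
  qed (use u in auto)
  moreover have "linear (blinfun_apply (D u))" for u
    by (simp add: blinfun.bounded_linear_right bounded_linear.linear)
  ultimately show ?thesis
    unfolding branch_family_def using continuous_on_norm_on_subspace[OF S N] by (intro exI[of _ "{N}"]) auto
qed

section \<open>The first-order expansion of the Baker--Campbell--Hausdorff product\<close>

text \<open>\<open>False\<close> stands for the first argument of the product and
  \<open>True\<close> for the second, so the degree in the second argument is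
  \<open>count_list (bch_word w) True\<close>.\<close>

definition bch_word :: "(nat \<times> nat) list \<Rightarrow> bool list" where
  "bch_word w = concat (map (\<lambda>(p, q). replicate p False @ replicate q True) w)"

definition bch_coeff :: "nat \<Rightarrow> (nat \<times> nat) list \<Rightarrow> real" where
  "bch_coeff n w =
    (-1) ^ (n - 1) / (real n * real (\<Sum>(p, q)\<leftarrow>w. p + q) * (\<Prod>(p, q)\<leftarrow>w. fact p * fact q))"

definition word_bracket :: "('a \<Rightarrow> 'a \<Rightarrow> 'a) \<Rightarrow> 'a \<Rightarrow> 'a \<Rightarrow> bool list \<Rightarrow> 'a::zero" where
  "word_bracket br x y bs = nested_bracket br (map (\<lambda>b. if b then y else x) bs)"

lemma word_bracket_simps [simp]:
  "word_bracket br x y [] = 0"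
  "word_bracket br x y [b] = (if b then y else x)"
  "word_bracket br x y (b # b' # bs) = br (if b then y else x) (word_bracket br x y (b' # bs))"
  by (simp_all add: word_bracket_def)

text \<open>Separates the words from the vectors that fill them, so that the terms can be sorted by
  their degree in \<open>y\<close>.\<close>

lemma bch_eq_word_bracket:
  "bch br s x y = (\<Sum>n=1..s. \<Sum>w\<in>bch_indices s n. bch_coeff n w *\<^sub>R word_bracket br x y (bch_word w))"
proof -
  have "concat (map (\<lambda>(p, q). replicate p x @ replicate q y) w) =
      map (\<lambda>b. if b then y else x) (bch_word w)" for w
    by (induction w) (auto simp: bch_word_def)
  then show ?thesis
    unfolding bch_def bch_coeff_def word_bracket_def by simp
qed

lemma length_bch_word: "length (bch_word w) = (\<Sum>(p, q)\<leftarrow>w. p + q)"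
  by (induction w) (auto simp: bch_word_def)

context real_lie_algebra
begin

lemma bounded_bilinear_bracket: "bounded_bilinear bracket"
  using bilinear_bracket by (simp add: bilinear_conv_bounded_bilinear)

lemmas bracket_zero [simp] = bilinear_lzero[OF bilinear_bracket] bilinear_rzero[OF bilinear_bracket]

lemma bracket_swap: "bracket x y = - bracket y x"
proof -
  have "bracket (x + y) (x + y) = bracket x y + bracket y x"
    unfolding bilinear_ladd[OF bilinear_bracket] bilinear_radd[OF bilinear_bracket]
    by (simp add: alternating)
  then show ?thesis
    by (simp add: alternating eq_neg_iff_add_eq_0)
qed

lemma tendsto_word_bracket:
  assumes "(X \<longlongrightarrow> x) F" "(Y \<longlongrightarrow> y) F"
  shows "((\<lambda>n. word_bracket bracket (X n) (Y n) bs) \<longlongrightarrow> word_bracket bracket x y bs) F"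
proof (induction bs rule: induct_list012)
  case (3 b b' bs)
  then show ?case
    using assms by (auto intro!: bounded_bilinear.tendsto[OF bounded_bilinear_bracket])
qed (use assms in auto)

lemma tendsto_bch:
  assumes "(X \<longlongrightarrow> x) F" "(Y \<longlongrightarrow> y) F"
  shows "((\<lambda>n. bch bracket s (X n) (Y n)) \<longlongrightarrow> bch bracket s x y) F"
  unfolding bch_eq_word_bracket
  by (intro tendsto_sum tendsto_scaleR tendsto_const tendsto_word_bracket assms)

text \<open>The bracket is linear in each slot, and \<open>True\<close> marks the slots holding
  \<open>y\<close>.\<close>

lemma word_bracket_scaleR:
  "word_bracket bracket x (c *\<^sub>R y) bs = c ^ count_list bs True *\<^sub>R word_bracket bracket x y bs"
proof (induction bs rule: induct_list012)
  case (3 b b' bs)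
  show ?case
    using 3(2)
    by (cases b) (simp_all add: bilinear_lmul[OF bilinear_bracket] bilinear_rmul[OF bilinear_bracket])
qed auto

text \<open>Homogeneity with \<open>c = 0\<close>: as \<open>0 ^ 0 = 1\<close>, both sides equal the
  value at the zero vector.\<close>

lemma word_bracket_constant:
  assumes "count_list bs True = 0"
  shows "word_bracket bracket x y bs = word_bracket bracket x z bs"
  using word_bracket_scaleR[of x 0 y bs] word_bracket_scaleR[of x 0 z bs] assms by simp

text \<open>If the only \<open>y\<close> is the outermost entry, the remaining word does not depend
  on \<open>y\<close>; otherwise the outermost entry is \<open>x\<close> and the induction continues
  inside.\<close>

lemma linear_word_bracket:
  assumes "count_list bs True = 1"
  shows "linear (\<lambda>y. word_bracket bracket x y bs)"
  using assms
proof (induction bs rule: induct_list012)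
  case (2 b)
  then show ?case
    by (auto split: if_splits intro: linear_ident)
next
  case (3 b b' bs)
  show ?case
  proof (cases b)
    case True
    then have "count_list (b' # bs) True = 0"
      using 3(3) by simp
    then have "word_bracket bracket x y (b # b' # bs) = bracket y (word_bracket bracket x 0 (b' # bs))" for y
      using True word_bracket_constant[of "b' # bs" x y 0] by simp
    then show ?thesis
      using bilinear_bracket by (simp add: bilinear_def)
  next
    case False
    then have "linear (\<lambda>y. word_bracket bracket x y (b' # bs))"
      using 3 by simp
    moreover have "linear (bracket x)"
      using bilinear_bracket by (simp add: bilinear_def)
    ultimately have "linear (bracket x \<circ> (\<lambda>y. word_bracket bracket x y (b' # bs)))"
      by (rule linear_compose)
    then show ?thesis
      using False by (simp add: o_def)
  qed
qed auto

text \<open>The innermost bracket is \<open>[x, x]\<close>, \<open>[x, y]\<close>,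
  \<open>[y, x]\<close> or \<open>[y, y]\<close>, and all of these vanish.\<close>

lemma word_bracket_commuting:
  assumes "bracket x y = 0" "2 \<le> length bs"
  shows "word_bracket bracket x y bs = 0"
  using assms(2)
proof (induction bs rule: induct_list012)
  case (3 b b' bs)
  then show ?case
    using assms(1) bracket_swap[of x y] by (cases bs) (auto simp: alternating)
qed auto

text \<open>Only the two one-letter words survive. This yields the unit, the inverses and the
  zeroth-order term of the expansion.\<close>

lemma bch_commuting:
  assumes "bracket x y = 0" "1 \<le> s"
  shows "bch bracket s x y = x + y"
proof -
  let ?t = "\<lambda>n w. bch_coeff n w *\<^sub>R word_bracket bracket x y (bch_word w)"
  \<comment> \<open>Any other index has total degree at least two, or is empty with word bracket
    \<open>0\<close>.\<close>
  have zero: "?t n w = 0" if w: "w \<in> bch_indices s n" "w \<noteq> [(1, 0)]" "w \<noteq> [(0, 1)]" for n w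
  proof (cases "2 \<le> length (bch_word w)")
    case True
    then show ?thesis
      using word_bracket_commuting[OF assms(1)] by simp
  next
    case False
    have *: "\<forall>(p, q)\<in>set w. 0 < p + q" "(\<Sum>(p, q)\<leftarrow>w. p + q) < 2"
      using w False by (auto simp: bch_indices_def length_bch_word)
    show ?thesis
    proof (cases w)
      case (Cons a w')
      with * w show ?thesis
        by (cases a; cases w') (auto simp: add_eq_if split: if_splits)
    qed (simp add: bch_word_def)
  qed
  have one: "(\<Sum>w\<in>bch_indices s 1. ?t 1 w) = (\<Sum>w\<in>{[(1, 0)], [(0, 1)]}. ?t 1 w)"
    using assms(2) zero[of _ 1]
    by (intro sum.mono_neutral_right[OF finite_bch_indices]) (auto simp: bch_indices_def)
  have rest: "(\<Sum>w\<in>bch_indices s n. ?t n w) = 0" if "n \<noteq> 1" for n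
    using that by (intro sum.neutral ballI zero) (auto simp: bch_indices_def)
  have "bch bracket s x y = (\<Sum>n=1..s. if n = 1 then (\<Sum>w\<in>bch_indices s 1. ?t 1 w) else 0)"
    unfolding bch_eq_word_bracket using rest by (intro sum.cong) auto
  also have "\<dots> = x + y"
    using assms(2) one by (simp add: bch_coeff_def bch_word_def)
  finally show ?thesis .
qed

text \<open>The derivative at \<open>0\<close> of left translation by \<open>p\<close>, in direction
  \<open>z\<close>.\<close>

definition bch_linear_part :: "nat \<Rightarrow> 'a \<Rightarrow> 'a \<Rightarrow> 'a" where
  "bch_linear_part s p z = (\<Sum>n=1..s. \<Sum>w\<in>bch_indices s n.
    if count_list (bch_word w) True = 1 then bch_coeff n w *\<^sub>R word_bracket bracket p z (bch_word w) else 0)"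

lemma linear_bch_linear_part: "linear (bch_linear_part s p)"
  unfolding bch_linear_part_def
proof (intro linear_compose_sum ballI)
  show "linear (\<lambda>z. if count_list (bch_word w) True = 1
      then bch_coeff n w *\<^sub>R word_bracket bracket p z (bch_word w) else 0)" for n w
    using linear_word_bracket[of "bch_word w" p]
    by (cases "count_list (bch_word w) True = 1") (auto intro: linear_compose_scale_right linear_zero)
qed

text \<open>Subtracting the product with \<open>0\<close> word by word cancels degree zero in the
  second argument; degree one converges after division by \<open>e m\<close>, and higher degrees
  keep a positive power of \<open>e m\<close>.\<close>

lemma bch_first_order:
  assumes p: "p \<longlonglongrightarrow> p\<^sub>0" and z: "z \<longlonglongrightarrow> z\<^sub>0" and e: "e \<longlonglongrightarrow> 0" "\<And>n. 0 < e n" and "1 \<le> s"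
  shows "(\<lambda>m. (1 / e m) *\<^sub>R (bch bracket s (p m) (e m *\<^sub>R z m) - p m)) \<longlonglongrightarrow> bch_linear_part s p\<^sub>0 z\<^sub>0"
proof -
  have word: "(\<lambda>m. (1 / e m) *\<^sub>R
        (word_bracket bracket (p m) (e m *\<^sub>R z m) bs - word_bracket bracket (p m) 0 bs))
      \<longlonglongrightarrow> (if count_list bs True = 1 then word_bracket bracket p\<^sub>0 z\<^sub>0 bs else 0)" for bs
  proof (cases "count_list bs True")
    case 0
    then have "word_bracket bracket (p m) (e m *\<^sub>R z m) bs = word_bracket bracket (p m) 0 bs" for m
      by (rule word_bracket_constant)
    with 0 show ?thesis
      by simp
  next
    case (Suc k)
    \<comment> \<open>A word containing \<open>True\<close> vanishes at \<open>0\<close>. Division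
      cancels one factor \<open>e m\<close>, and in the limit \<open>0 ^ k\<close> is
      \<open>1\<close> exactly for degree one.\<close>
    have "(1 / e m) *\<^sub>R (word_bracket bracket (p m) (e m *\<^sub>R z m) bs - word_bracket bracket (p m) 0 bs)
        = e m ^ k *\<^sub>R word_bracket bracket (p m) (z m) bs" for m
      using e(2)[of m] word_bracket_scaleR[of "p m" 0 0 bs]
      by (simp add: word_bracket_scaleR Suc)
    moreover have "(\<lambda>m. e m ^ k *\<^sub>R word_bracket bracket (p m) (z m) bs)
        \<longlonglongrightarrow> 0 ^ k *\<^sub>R word_bracket bracket p\<^sub>0 z\<^sub>0 bs"
      by (intro tendsto_intros tendsto_word_bracket e p z)
    ultimately show ?thesis
      using Suc by (cases k) auto
  qed
  have "(1 / e m) *\<^sub>R (bch bracket s (p m) (e m *\<^sub>R z m) - p m) =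
      (\<Sum>n=1..s. \<Sum>w\<in>bch_indices s n. bch_coeff n w *\<^sub>R ((1 / e m) *\<^sub>R
        (word_bracket bracket (p m) (e m *\<^sub>R z m) (bch_word w)
          - word_bracket bracket (p m) 0 (bch_word w))))" for m
  proof -
    have "p m = bch bracket s (p m) 0"
      using bch_commuting[of "p m" 0 s] assms(5) by simp
    then have "(1 / e m) *\<^sub>R (bch bracket s (p m) (e m *\<^sub>R z m) - p m) =
        (1 / e m) *\<^sub>R (bch bracket s (p m) (e m *\<^sub>R z m) - bch bracket s (p m) 0)"
      by simp
    also have "\<dots> = (\<Sum>n=1..s. \<Sum>w\<in>bch_indices s n. bch_coeff n w *\<^sub>R ((1 / e m) *\<^sub>R
        (word_bracket bracket (p m) (e m *\<^sub>R z m) (bch_word w)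
          - word_bracket bracket (p m) 0 (bch_word w))))"
      unfolding bch_eq_word_bracket
      by (simp add: sum_subtractf scaleR_sum_right scaleR_diff_right scaleR_left_commute mult.commute)
    finally show ?thesis .
  qed
  moreover have "(\<lambda>m. \<Sum>n=1..s. \<Sum>w\<in>bch_indices s n. bch_coeff n w *\<^sub>R ((1 / e m) *\<^sub>R
        (word_bracket bracket (p m) (e m *\<^sub>R z m) (bch_word w)
          - word_bracket bracket (p m) 0 (bch_word w))))
      \<longlonglongrightarrow> (\<Sum>n=1..s. \<Sum>w\<in>bch_indices s n. bch_coeff n w *\<^sub>R
        (if count_list (bch_word w) True = 1 then word_bracket bracket p\<^sub>0 z\<^sub>0 (bch_word w) else 0))"
    by (intro tendsto_sum tendsto_scaleR tendsto_const word)
  ultimately show ?thesis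
    unfolding bch_linear_part_def by (simp add: if_distrib cong: if_cong)
qed

end

lemma nested_bracket_hom:
  assumes "h 0 = 0" "\<And>x y. h (br x y) = br (h x) (h y)"
  shows "h (nested_bracket br xs) = nested_bracket br (map h xs)"
  by (induction xs rule: induct_list012) (auto simp: assms)

text \<open>Applied to dilations, which thereby respect the group product.\<close>

lemma bch_hom:
  assumes "linear h" "\<And>x y. h (br x y) = br (h x) (h y)"
  shows "h (bch br s x y) = bch br s (h x) (h y)"
proof -
  have "h (word_bracket br x y bs) = word_bracket br (h x) (h y) bs" for bs
    unfolding word_bracket_def
    by (subst nested_bracket_hom) (auto simp: assms linear_0 intro!: arg_cong[where f = "nested_bracket br"])
  then show ?thesis
    unfolding bch_eq_word_bracket by (simp add: linear_sum[OF assms(1)] linear_cmul[OF assms(1)])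
qed

section \<open>Layers and dilations\<close>

context stratified_lie_algebra
begin

abbreviation proj :: "nat \<Rightarrow> 'a \<Rightarrow> 'a" where
  "proj \<equiv> layer_proj s V"

lemma
  shows layer_proj_in: "j \<in> {1..s} \<Longrightarrow> proj j x \<in> V j"
    and sum_layer_proj: "(\<Sum>j=1..s. proj j x) = x"
  using theI'[OF direct_sum[of x]] unfolding layer_proj_def by (auto simp: PiE_iff)

lemma layer_proj_unique:
  assumes "\<And>i. i \<in> {1..s} \<Longrightarrow> u i \<in> V i" "x = (\<Sum>i=1..s. u i)" "j \<in> {1..s}"
  shows "proj j x = u j"
proof -
  have "(THE v. v \<in> (\<Pi>\<^sub>E i\<in>{1..s}. V i) \<and> x = (\<Sum>i=1..s. v i)) = restrict u {1..s}"
    using assms by (intro the1_equality direct_sum) auto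
  then show ?thesis
    using assms(3) by (simp add: layer_proj_def)
qed

lemma linear_layer_proj:
  assumes "j \<in> {1..s}"
  shows "linear (proj j)"
proof (rule linearI)
  show "proj j (x + y) = proj j x + proj j y" for x y
    by (rule layer_proj_unique[OF _ _ assms])
      (simp_all add: subspace_add[OF subspace_layer] layer_proj_in sum.distrib sum_layer_proj
        del: atLeastAtMost_iff One_nat_def)
  show "proj j (c *\<^sub>R x) = c *\<^sub>R proj j x" for c x
    by (rule layer_proj_unique[OF _ _ assms])
      (simp_all add: subspace_scale[OF subspace_layer] layer_proj_in sum_layer_proj
        flip: scaleR_sum_right del: atLeastAtMost_iff One_nat_def)
qed

lemma tendsto_layer_proj:
  assumes "j \<in> {1..s}" "(X \<longlongrightarrow> x) F"
  shows "((\<lambda>n. proj j (X n)) \<longlongrightarrow> proj j x) F"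
  by (rule bounded_linear.tendsto[OF linear_conv_bounded_linear[THEN iffD1, OF linear_layer_proj]])
    (fact assms)+

lemma layer_proj_layer:
  assumes "v \<in> V k" "k \<in> {1..s}" "j \<in> {1..s}"
  shows "proj j v = (if j = k then v else 0)"
  by (rule layer_proj_unique)
    (use assms in \<open>auto simp: subspace_0[OF subspace_layer] sum.delta\<close>)

text \<open>Replaces \<open>V\<close> by the zero space outside \<open>{1..s}\<close>, where its
  values may be arbitrary, so that the grading rule for brackets needs no side conditions.\<close>

definition layer :: "nat \<Rightarrow> 'a set" where
  "layer j = (if j \<in> {1..s} then V j else {0})"

lemma subspace_layer': "subspace (layer j)"
  using subspace_layer by (auto simp: layer_def)

text \<open>The axioms speak only of brackets with \<open>V 1\<close>. As \<open>V (Suc i)\<close>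
  is spanned by brackets of \<open>V 1\<close> with \<open>V i\<close>, induction on
  \<open>i\<close> and the Jacobi identity \<open>[[a, b], v] = [a, [b, v]] - [b, [a, v]]\<close>
  give the rest.\<close>

lemma bracket_layers:
  assumes "u \<in> layer i" "v \<in> layer j"
  shows "bracket u v \<in> layer (i + j)"
proof -
  have first: "bracket a v \<in> layer (Suc j)" if a: "a \<in> V 1" and v: "v \<in> layer j" for a v j
  proof (cases "j \<in> {1..s}")
    case True
    then have "bracket a v \<in> V (Suc j)"
      using a v True by (auto simp: layer_def simp flip: generating[OF True] intro!: span_base)
    then show ?thesis
      using True beyond_last_layer by (cases "j = s") (auto simp: layer_def)
  next
    case False
    then have "v = 0"
      using v by (auto simp: layer_def)
    then show ?thesis
      by (simp add: subspace_0[OF subspace_layer'])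
  qed
  have "\<forall>u\<in>layer i. \<forall>v\<in>layer j. bracket u v \<in> layer (i + j)" for j
  proof (induction i arbitrary: j)
    case 0
    then show ?case
      using subspace_0[OF subspace_layer'[of j]] by (simp add: layer_def[of 0])
  next
    case (Suc i)
    show ?case
    proof (intro ballI)
      fix u v assume u: "u \<in> layer (Suc i)" and v: "v \<in> layer j"
      \<comment> \<open>\<open>layer 0\<close> is the zero space, so the induction effectively
        starts at \<open>Suc i = 1\<close>, the second case.\<close>
      consider "Suc i \<notin> {1..s}" | "i = 0" "1 \<le> s" | "i \<in> {1..s}" "Suc i \<in> {1..s}"
        using step_pos by (cases i) auto
      then show "bracket u v \<in> layer (Suc i + j)"
      proof cases
        case 1
        then have "u = 0"
          using u by (auto simp: layer_def)
        then show ?thesis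
          by (simp add: subspace_0[OF subspace_layer'])
      next
        case 2
        then show ?thesis
          using first u v by (auto simp: layer_def)
      next
        case 3
        let ?T = "{u. bracket u v \<in> layer (Suc i + j)}"
        have "u \<in> span {bracket a b |a b. a \<in> V 1 \<and> b \<in> V i}"
          using u 3 generating[of i] by (simp add: layer_def)
        also have "\<dots> \<subseteq> ?T"
        proof (rule span_minimal)
          show "subspace ?T"
            unfolding subspace_def
            by (auto simp: bilinear_ladd[OF bilinear_bracket] bilinear_lmul[OF bilinear_bracket]
                subspace_0[OF subspace_layer'] subspace_add[OF subspace_layer']
                subspace_scale[OF subspace_layer'])
          show "{bracket a b |a b. a \<in> V 1 \<and> b \<in> V i} \<subseteq> ?T"
          proof clarify
            fix a b assume a: "a \<in> V 1" and b: "b \<in> V i"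
            have "bracket (bracket a b) v = bracket a (bracket b v) - bracket b (bracket a v)"
              using jacobi[of a b v]
              unfolding bracket_swap[of v "bracket a b"] bracket_swap[of v a] bilinear_rneg[OF bilinear_bracket]
              by simp
            moreover have "bracket a (bracket b v) \<in> layer (Suc (i + j))"
              using Suc b v a 3 by (intro first) (auto simp: layer_def)
            moreover have "bracket b (bracket a v) \<in> layer (i + Suc j)"
              using Suc[of "Suc j"] first[OF a v] b 3 by (auto simp: layer_def)
            ultimately show "bracket (bracket a b) v \<in> layer (Suc i + j)"
              by (simp add: subspace_diff[OF subspace_layer'])
          qed
        qed
        finally show ?thesis
          by simp
      qed
    qed
  qed
  then show ?thesis
    using assms by blast
qed

lemma linear_dilation: "linear (dilation s V t)"
  unfolding dilation_def
  by (intro linear_compose_sum ballI linear_compose_scale_right linear_layer_proj)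

lemma layer_proj_dilation:
  assumes "j \<in> {1..s}"
  shows "proj j (dilation s V t x) = t ^ j *\<^sub>R proj j x"
  by (rule layer_proj_unique[OF _ _ assms])
    (simp_all add: dilation_def subspace_scale[OF subspace_layer] layer_proj_in del: atLeastAtMost_iff One_nat_def)

lemma dilation_layer:
  assumes "v \<in> layer k"
  shows "dilation s V t v = t ^ k *\<^sub>R v"
proof (cases "k \<in> {1..s}")
  case True
  have "dilation s V t v = (\<Sum>j=1..s. if j = k then t ^ k *\<^sub>R v else 0)"
    unfolding dilation_def using assms True
    by (intro sum.cong) (auto simp: layer_proj_layer layer_def)
  then show ?thesis
    using True by simp
next
  case False
  then show ?thesis
    using assms linear_0[OF linear_dilation] by (auto simp: layer_def)
qed

text \<open>On a bracket of layers \<open>i\<close> and \<open>j\<close> the dilation acts by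
  \<open>t ^ (i + j) = t ^ i * t ^ j\<close>; bilinearity does the rest.\<close>

lemma dilation_bracket:
  "dilation s V t (bracket x y) = bracket (dilation s V t x) (dilation s V t y)"
proof -
  let ?I = "{1..s} \<times> {1..s}"
  have in_layer: "proj i x \<in> layer i" if "i \<in> {1..s}" for i x
    using layer_proj_in[OF that] that by (simp add: layer_def)
  have "dilation s V t (bracket (\<Sum>i=1..s. proj i x) (\<Sum>j=1..s. proj j y)) =
      (\<Sum>(i, j)\<in>?I. dilation s V t (bracket (proj i x) (proj j y)))"
    unfolding bilinear_sum[OF bilinear_bracket] linear_sum[OF linear_dilation]
    by (simp add: case_prod_unfold)
  also have "\<dots> = (\<Sum>(i, j)\<in>?I. bracket (t ^ i *\<^sub>R proj i x) (t ^ j *\<^sub>R proj j y))"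
    by (intro sum.cong refl)
      (auto simp: dilation_layer[OF bracket_layers[OF in_layer in_layer]] power_add
        bilinear_lmul[OF bilinear_bracket] bilinear_rmul[OF bilinear_bracket])
  also have "\<dots> = bracket (dilation s V t x) (dilation s V t y)"
    unfolding dilation_def bilinear_sum[OF bilinear_bracket] ..
  finally show ?thesis
    by (simp only: sum_layer_proj)
qed

text \<open>After division by \<open>e n\<close>, layer \<open>j\<close> carries the factor
  \<open>e n ^ (j - 1)\<close>, so only the first layer survives. This is why a blow-up depends on
  \<open>proj 1\<close> alone.\<close>

lemma dilation_first_order:
  assumes e: "e \<longlonglongrightarrow> 0" "\<And>n. 0 < e n"
  shows "(\<lambda>n. (1 / e n) *\<^sub>R dilation s V (e n) x) \<longlonglongrightarrow> proj 1 x"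
proof -
  have "(1 / e n) *\<^sub>R dilation s V (e n) x = (\<Sum>j=1..s. e n ^ (j - 1) *\<^sub>R proj j x)" for n
    unfolding dilation_def scaleR_sum_right
    by (intro sum.cong refl) (use e(2)[of n] in \<open>auto simp: power_eq_if\<close>)
  moreover have "(\<lambda>n. \<Sum>j=1..s. e n ^ (j - 1) *\<^sub>R proj j x) \<longlonglongrightarrow> (\<Sum>j=1..s. 0 ^ (j - 1) *\<^sub>R proj j x)"
    by (intro tendsto_intros e)
  moreover have "(\<Sum>j=1..s. 0 ^ (j - 1) *\<^sub>R proj j x) = (\<Sum>j=1..s. if j = 1 then proj 1 x else 0)"
    by (intro sum.cong) auto
  ultimately show ?thesis
    using step_pos by simp
qed

end

section \<open>Unit, inverses and dilations of the group\<close>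

context stratified_group
begin

text \<open>\<open>0\<close> is idempotent, and the unit is the only idempotent of a group.\<close>

lemma one_eq_0: "\<one> = 0"
proof -
  have "0 \<otimes> 0 = 0"
    using bch_commuting[of 0 0 s] step_pos by (simp add: mult_eq_bch)
  then show ?thesis
    using l_cancel_one'[of 0 0] by (simp add: carrier_eq)
qed

lemma inv_eq_uminus: "inv x = - x"
proof -
  have "- x \<otimes> x = \<one>"
    using bch_commuting[of "- x" x s] step_pos
    by (simp add: mult_eq_bch one_eq_0 bilinear_lneg[OF bilinear_bracket] alternating)
  then show ?thesis
    by (simp add: inv_equality carrier_eq)
qed

lemma dilation_mult: "dilation s V t (x \<otimes> y) = dilation s V t x \<otimes> dilation s V t y"
  unfolding mult_eq_bch by (rule bch_hom[where h = "dilation s V t" and br = bracket, OF linear_dilation dilation_bracket])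

lemma tendsto_mult_group:
  assumes "(X \<longlongrightarrow> x) F" "(Y \<longlongrightarrow> y) F"
  shows "((\<lambda>n. X n \<otimes> Y n) \<longlongrightarrow> x \<otimes> y) F"
  unfolding mult_eq_bch by (rule tendsto_bch[OF assms])

end

section \<open>Layered sup norms\<close>

locale layered_norm_group = stratified_group G bracket s V
  for G :: "'a::euclidean_space monoid" (structure)
    and bracket :: "'a \<Rightarrow> 'a \<Rightarrow> 'a" and s :: nat and V :: "nat \<Rightarrow> 'a set" +
  fixes N :: "nat \<Rightarrow> 'a \<Rightarrow> real"
  assumes layered_sup_norm: "layered_sup_norm G s V N"
begin

abbreviation nrm :: "'a \<Rightarrow> real" where
  "nrm \<equiv> layered_sup s V N"

lemma layer_norm: "j \<in> {1..s} \<Longrightarrow> norm_on_subspace (V j) (N j)"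
  and nrm_mult_le: "nrm (x \<otimes> y) \<le> nrm x + nrm y"
  using layered_sup_norm unfolding layered_sup_norm_def by (auto simp: carrier_eq)

lemma layer_norm_nonneg: "j \<in> {1..s} \<Longrightarrow> 0 \<le> N j (proj j x)"
  by (rule norm_on_subspace_nonneg[OF layer_norm layer_proj_in])

lemma layers_nonempty: "{1..s} \<noteq> {}"
  using step_pos by simp

lemma root_layer_le_nrm:
  assumes "j \<in> {1..s}"
  shows "root j (N j (proj j x)) \<le> nrm x"
  unfolding layered_sup_def using assms by (intro Max_ge) auto

lemma layer_norm_le:
  assumes "j \<in> {1..s}"
  shows "N j (proj j x) \<le> nrm x ^ j"
proof -
  have "root j (N j (proj j x)) ^ j \<le> nrm x ^ j"
    using assms layer_norm_nonneg[OF assms, of x]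
    by (intro power_mono root_layer_le_nrm real_root_ge_zero)
  then show ?thesis
    using assms layer_norm_nonneg[OF assms, of x] by simp
qed

lemma nrm_nonneg: "0 \<le> nrm x"
proof -
  have "0 \<le> root 1 (N 1 (proj 1 x))"
    using step_pos by (intro real_root_ge_zero layer_norm_nonneg) auto
  also have "\<dots> \<le> nrm x"
    using step_pos by (intro root_layer_le_nrm) auto
  finally show ?thesis .
qed

lemma nrm_dilation:
  assumes "0 < t"
  shows "nrm (dilation s V t x) = t * nrm x"
proof -
  have "root j (N j (proj j (dilation s V t x))) = t * root j (N j (proj j x))" if "j \<in> {1..s}" for j
    using assms that
    by (simp add: layer_proj_dilation norm_on_subspace_scaleR[OF layer_norm layer_proj_in]
        real_root_mult real_root_power_cancel)
  then have "nrm (dilation s V t x) = (MAX j\<in>{1..s}. t * root j (N j (proj j x)))"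
    unfolding layered_sup_def by (intro arg_cong[where f = Max] image_cong refl)
  also have "\<dots> = t * nrm x"
    unfolding layered_sup_def using assms layers_nonempty
      mono_Max_commute[of "(*) t" "(\<lambda>j. root j (N j (proj j x))) ` {1..s}"]
    by (simp add: mono_def image_image)
  finally show ?thesis .
qed

lemma nrm_uminus: "nrm (- x) = nrm x"
proof -
  have "N j (proj j (- x)) = N j (proj j x)" if "j \<in> {1..s}" for j
    using norm_on_subspace_scaleR[OF layer_norm[OF that] layer_proj_in[OF that], of "-1" x]
    by (simp add: linear_neg[OF linear_layer_proj[OF that]])
  then show ?thesis
    unfolding layered_sup_def by (intro arg_cong[where f = Max] image_cong) auto
qed

lemma nrm_eq_0_iff: "nrm x = 0 \<longleftrightarrow> x = 0"
proof
  assume x: "nrm x = 0"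
  have "proj j x = 0" if j: "j \<in> {1..s}" for j
  proof -
    have "N j (proj j x) = 0"
      using layer_norm_le[OF j, of x] layer_norm_nonneg[OF j, of x] x j by (simp add: power_0_left)
    then show ?thesis
      using norm_on_subspace_eq_0[OF layer_norm[OF j] layer_proj_in[OF j]] by blast
  qed
  then show "x = 0"
    using sum_layer_proj[of x] by simp
next
  assume "x = 0"
  moreover have "root j (N j (proj j 0)) = 0" if "j \<in> {1..s}" for j
    using that norm_on_subspace_eq_0[OF layer_norm[OF that] layer_proj_in[OF that], of 0]
    by (simp add: linear_0[OF linear_layer_proj])
  ultimately show "nrm x = 0"
    unfolding layered_sup_def using layers_nonempty by (intro Max_eqI) (auto simp: image_iff)
qed

lemma tendsto_nrm:
  assumes "(X \<longlongrightarrow> x) F"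
  shows "((\<lambda>n. nrm (X n)) \<longlongrightarrow> nrm x) F"
  unfolding layered_sup_def
proof (intro tendsto_Max_image tendsto_real_root)
  fix j assume j: "j \<in> {1..s}"
  show "((\<lambda>n. N j (proj j (X n))) \<longlongrightarrow> N j (proj j x)) F"
    by (rule continuous_on_tendsto_compose[OF
          continuous_on_norm_on_subspace[OF subspace_layer[OF j] layer_norm[OF j]]])
      (intro tendsto_layer_proj layer_proj_in always_eventually allI j assms)+
qed (use layers_nonempty in auto)

text \<open>Each layer component is controlled by coercivity of \<open>N j\<close>. Bounds on
  \<open>nrm\<close> thus yield convergent subsequences.\<close>

lemma bounded_nrm_le: "bounded {x. nrm x \<le> R}"
proof -
  have "\<forall>j\<in>{1..s}. \<exists>C. 0 \<le> C \<and> (\<forall>x\<in>V j. norm x \<le> C * N j x)"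
    using norm_on_subspace_coercive[OF subspace_layer layer_norm] by blast
  from bchoice[OF this] obtain C where C: "\<And>j. j \<in> {1..s} \<Longrightarrow> 0 \<le> C j"
    "\<And>j x. j \<in> {1..s} \<Longrightarrow> x \<in> V j \<Longrightarrow> norm x \<le> C j * N j x"
    by blast
  have "norm x \<le> (\<Sum>j=1..s. C j * R ^ j)" if x: "nrm x \<le> R" for x
  proof -
    have "norm x = norm (\<Sum>j=1..s. proj j x)"
      by (simp only: sum_layer_proj)
    also have "\<dots> \<le> (\<Sum>j=1..s. norm (proj j x))"
      by (rule norm_sum)
    also have "\<dots> \<le> (\<Sum>j=1..s. C j * R ^ j)"
    proof (rule sum_mono)
      fix j assume j: "j \<in> {1..s}"
      have "norm (proj j x) \<le> C j * N j (proj j x)"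
        by (rule C(2)[OF j layer_proj_in[OF j]])
      also have "\<dots> \<le> C j * R ^ j"
        using layer_norm_le[OF j, of x] power_mono[OF x nrm_nonneg, of j] C(1)[OF j]
        by (intro mult_left_mono) auto
      finally show "norm (proj j x) \<le> C j * R ^ j" .
    qed
    finally show ?thesis .
  qed
  then show ?thesis
    by (auto simp: bounded_iff)
qed

section \<open>The left-invariant metric\<close>

abbreviation gdist :: "'a \<Rightarrow> 'a \<Rightarrow> real" where
  "gdist \<equiv> left_inv_dist G nrm"

lemma gdist_eq: "gdist x y = nrm (inv x \<otimes> y)"
  by (simp add: left_inv_dist_def)

lemma Metric_space_gdist: "Metric_space (carrier G) gdist"
proof
  fix x y z
  show "0 \<le> gdist x y"
    by (simp add: gdist_eq nrm_nonneg)
  \<comment> \<open>Symmetry: inversion is negation, which preserves \<open>nrm\<close>, and it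
    reverses products.\<close>
  have "gdist x y = nrm (inv (inv x \<otimes> y))"
    by (simp only: gdist_eq inv_eq_uminus[of "inv x \<otimes> y"] nrm_uminus)
  then show "gdist x y = gdist y x"
    by (simp add: gdist_eq inv_mult_group carrier_eq)
  show "gdist x y = 0 \<longleftrightarrow> x = y"
    unfolding gdist_eq nrm_eq_0_iff one_eq_0[symmetric]
    using inv_solve_left[of \<one> x y] by (auto simp: carrier_eq)
  have "y \<otimes> (inv y \<otimes> z) = z"
    by (simp add: carrier_eq flip: m_assoc)
  then have "inv x \<otimes> z = (inv x \<otimes> y) \<otimes> (inv y \<otimes> z)"
    by (simp add: carrier_eq m_assoc)
  then show "gdist x z \<le> gdist x y + gdist y z"
    unfolding gdist_eq using nrm_mult_le by metis
qed

section \<open>Blow-ups\<close>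

text \<open>Stated for pointwise limits, so that it serves blow-ups and rescaled horofunctions
  alike.\<close>

lemma blow_up_limit:
  assumes poly: "polysmooth s V N"
    and P: "P \<longlonglongrightarrow> p" "nrm p = 1"
    and e: "e \<longlonglongrightarrow> 0" "\<And>n. 0 < e n"
    and lim: "\<And>x. (\<lambda>n. (nrm (P n \<otimes> dilation s V (e n) x) - nrm (P n)) / e n) \<longlonglongrightarrow> f x"
  shows "\<exists>g. piecewise_linear_on (V 1) g \<and> (\<forall>x. f x = g (proj 1 x))"
proof -
  have "\<forall>j\<in>{1..s}. \<exists>\<Phi>. branch_family (V j) (N j) \<Phi>"
    using poly unfolding polysmooth_def
    by (intro ballI norm_branches subspace_layer layer_norm) auto
  from bchoice[OF this] obtain \<Phi> where \<Phi>: "\<forall>j\<in>{1..s}. branch_family (V j) (N j) (\<Phi> j)"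
    by (rule exE)
  have fin: "finite (\<Phi> j)" and ne: "\<Phi> j \<noteq> {}" and
    Max: "\<And>v. v \<in> V j \<Longrightarrow> N j v = (MAX h\<in>\<Phi> j. h v)" and
    cont: "\<And>h. h \<in> \<Phi> j \<Longrightarrow> continuous_on (V j) h" and
    strict: "\<And>h u. h \<in> \<Phi> j \<Longrightarrow> u \<in> V j \<Longrightarrow> u \<noteq> 0 \<Longrightarrow>
      \<exists>D. linear D \<and> strict_derivative_within h D (V j) u"
    if "j \<in> {1..s}" for j
    using bspec[OF \<Phi> that] unfolding branch_family_def by auto
  define I where "I = Sigma {1..s} \<Phi>"
  define \<phi> where "\<phi> i y = root (fst i) (snd i (proj (fst i) y))" for i :: "nat \<times> ('a \<Rightarrow> real)" and y
  have I: "finite I" "I \<noteq> {}"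
    using fin ne[of 1] step_pos by (auto simp: I_def Sigma_empty_iff)
  have nrm_eq: "nrm y = (MAX i\<in>I. \<phi> i y)" for y
  proof -
    \<comment> \<open>\<open>root j\<close> is increasing on all of the reals, so it commutes with
      the maximum even where a branch is negative.\<close>
    have "root j (N j (proj j y)) = (MAX h\<in>\<Phi> j. root j (h (proj j y)))" if j: "j \<in> {1..s}" for j
      using j fin[OF j] ne[OF j] Max[OF j layer_proj_in[OF j]]
        mono_Max_commute[of "root j" "(\<lambda>h. h (proj j y)) ` \<Phi> j"]
      by (simp add: mono_def image_image)
    then have "nrm y = (MAX j\<in>{1..s}. MAX h\<in>\<Phi> j. root j (h (proj j y)))"
      unfolding layered_sup_def by (intro arg_cong[where f = Max] image_cong refl)
    also have "\<dots> = (MAX (j, h)\<in>I. root j (h (proj j y)))"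
      unfolding I_def by (intro Max_image_Sigma layers_nonempty fin ne) auto
    finally show ?thesis
      by (simp add: \<phi>_def case_prod_unfold)
  qed
  have \<phi>_le: "\<phi> i y \<le> nrm y" if "i \<in> I" for i y
    unfolding nrm_eq using I that by (intro Max_ge) auto
  have tendsto_branch: "(\<lambda>n. snd i (proj (fst i) (X n))) \<longlonglongrightarrow> snd i (proj (fst i) x)"
    if "X \<longlonglongrightarrow> x" "i \<in> I" for X x i
  proof -
    have i: "fst i \<in> {1..s}" "snd i \<in> \<Phi> (fst i)"
      using that by (auto simp: I_def)
    show ?thesis
      by (rule continuous_on_tendsto_compose[OF cont[OF i]])
        (intro tendsto_layer_proj layer_proj_in always_eventually allI i that)+
  qed

  define Q where "Q n x = P n \<otimes> dilation s V (e n) x" for n x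
  \<comment> \<open>The rescaled increment; by the first-order expansions of dilation and product it
    tends to \<open>B (proj 1 x)\<close>.\<close>
  define v where "v n x = (1 / e n) *\<^sub>R (Q n x - P n)" for n x
  define B where "B = bch_linear_part s p"
  have Q_eq: "Q n x = P n + e n *\<^sub>R v n x" for n x
    using e(2)[of n] by (simp add: v_def)
  have v: "(\<lambda>n. v n x) \<longlonglongrightarrow> B (proj 1 x)" for x
    using bch_first_order[OF P(1) dilation_first_order[OF e] e step_pos, of x] e(2)
    by (simp add: v_def Q_def B_def mult_eq_bch less_imp_neq[symmetric])
  have Q: "(\<lambda>n. Q n x) \<longlonglongrightarrow> p" for x
    using tendsto_add[OF P(1) tendsto_scaleR[OF e(1) v[of x]]] by (simp add: Q_eq)

  define A where "A = {i\<in>I. \<phi> i p = 1}"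
  define X where "X i n x = (\<phi> i (Q n x) - nrm (P n)) / e n" for i n x
  \<comment> \<open>The offset, independent of \<open>x\<close>: \<open>X i n x - c i n\<close> is
    the difference quotient of \<open>\<phi> i\<close> between \<open>P n\<close> and
    \<open>Q n x\<close>.\<close>
  define c where "c i n = (\<phi> i (P n) - nrm (P n)) / e n" for i n
  have "\<exists>L. linear L \<and> (\<forall>x. (\<lambda>n. X i n x - c i n) \<longlonglongrightarrow> L (proj 1 x))" if i: "i \<in> A" for i
  proof -
    obtain j h where jh: "i = (j, h)" "j \<in> {1..s}" "h \<in> \<Phi> j" "root j (h (proj j p)) = 1"
      using i by (cases i) (auto simp: A_def I_def \<phi>_def)
    then have h1: "h (proj j p) = 1"
      by simp
    \<comment> \<open>A branch is at most the norm, so \<open>h 0 \<le> 0\<close> and the value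
      \<open>1\<close> is taken at a nonzero vector, where \<open>h\<close> has a strict
      derivative.\<close>
    have "h 0 \<le> N j 0"
      using jh fin subspace_0[OF subspace_layer[OF jh(2)]] by (auto simp: Max)
    then have "proj j p \<noteq> 0"
      using h1 norm_on_subspace_eq_0[OF layer_norm[OF jh(2)] subspace_0[OF subspace_layer[OF jh(2)]]]
      by auto
    then obtain D where D: "linear D" "strict_derivative_within h D (V j) (proj j p)"
      using strict[OF jh(2,3) layer_proj_in[OF jh(2)]] by blast
    obtain k where k: "strict_derivative_within (root j) (\<lambda>u. k * u) UNIV 1"
      using strict_derivative_within_root[of j] jh(2) by auto
    have "(\<lambda>n. X i n x - c i n) \<longlonglongrightarrow> k * D (proj j (B (proj 1 x)))" for x
    proof -
      \<comment> \<open>The chain rule by hand: the inner quotient \<open>w\<close> serves as the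
        converging direction for the strict derivative of \<open>root j\<close> at
        \<open>1\<close>.\<close>
      define w where "w n = (h (proj j (Q n x)) - h (proj j (P n))) / e n" for n
      have proj_Q: "proj j (Q n x) = proj j (P n) + e n *\<^sub>R proj j (v n x)" for n
        using linear_layer_proj[OF jh(2)] by (simp add: Q_eq linear_add linear_cmul)
      have "w \<longlonglongrightarrow> D (proj j (B (proj 1 x)))"
        unfolding w_def proj_Q
      proof (rule strict_derivative_withinD[OF D(2)])
        show "proj j (P n) + e n *\<^sub>R proj j (v n x) \<in> V j" for n
          unfolding proj_Q[symmetric] by (rule layer_proj_in[OF jh(2)])
      qed (intro tendsto_layer_proj layer_proj_in jh(2) P e v)+
      moreover have "(\<lambda>n. h (proj j (P n))) \<longlonglongrightarrow> 1"
        using tendsto_branch[OF P(1), of i] i jh(1) h1 by (simp add: A_def)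
      ultimately have "(\<lambda>n. (root j (h (proj j (P n)) + e n *\<^sub>R w n) - root j (h (proj j (P n)))) / e n)
          \<longlonglongrightarrow> k * D (proj j (B (proj 1 x)))"
        by (intro strict_derivative_withinD[OF k]) (use e in auto)
      moreover have "h (proj j (P n)) + e n *\<^sub>R w n = h (proj j (Q n x))" for n
        using e(2)[of n] by (simp add: w_def)
      ultimately show ?thesis
        by (simp add: X_def c_def \<phi>_def jh(1) flip: diff_divide_distrib)
    qed
    moreover have "linear (\<lambda>z. k * D (proj j (B z)))"
      using linear_compose_scale_right[OF linear_compose[OF linear_compose[OF linear_bch_linear_part
            linear_layer_proj[OF jh(2)]] D(1)]]
      by (simp add: B_def o_def)
    ultimately show ?thesis
      by blast
  qed
  then obtain L where L: "\<And>i. i \<in> A \<Longrightarrow> linear (L i)"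
    "\<And>i x. i \<in> A \<Longrightarrow> (\<lambda>n. X i n x - c i n) \<longlonglongrightarrow> L i (proj 1 x)"
    using bchoice[of A "\<lambda>i L. linear L \<and> (\<forall>x. (\<lambda>n. X i n x - c i n) \<longlonglongrightarrow> L (proj 1 x))"] by blast
  \<comment> \<open>The numerator tends to the negative number \<open>\<phi> i p - 1\<close> while
    \<open>1 / e n\<close> tends to infinity.\<close>
  have inactive: "filterlim (\<lambda>n. X i n x) at_bot sequentially" if i: "i \<in> I - A" for i x
  proof -
    have "(\<lambda>n. \<phi> i (Q n x) - nrm (P n)) \<longlonglongrightarrow> \<phi> i p - 1"
      unfolding \<phi>_def using i tendsto_nrm[OF P(1)] P(2)
      by (intro tendsto_diff tendsto_real_root tendsto_branch Q) auto
    moreover have "\<phi> i p - 1 < 0"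
      using \<phi>_le[of i p] i P(2) by (auto simp: A_def less_le)
    moreover have "filterlim (\<lambda>n. inverse (e n)) at_top sequentially"
      using e by (intro filterlim_inverse_at_top) auto
    ultimately show ?thesis
      unfolding X_def divide_inverse by (rule filterlim_tendsto_neg_mult_at_bot)
  qed
  have "(MAX i\<in>I. X i n x) = (nrm (Q n x) - nrm (P n)) / e n" for n x
    using I e(2)[of n] mono_Max_commute[of "\<lambda>t. (t - nrm (P n)) / e n" "(\<lambda>i. \<phi> i (Q n x)) ` I"]
    by (simp add: X_def nrm_eq[of "Q n x"] mono_def divide_right_mono image_image)
  then have "(\<lambda>n. MAX i\<in>I. X i n x) \<longlonglongrightarrow> f x" for x
    using lim[of x] by (simp add: Q_def)
  moreover have "c i n \<le> 0" if "i \<in> A" for i n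
    using \<phi>_le[of i "P n"] that e(2)[of n] by (simp add: c_def A_def divide_le_0_iff)
  moreover have "A \<subseteq> I"
    by (auto simp: A_def)
  ultimately obtain J b where J: "J \<subseteq> A" "J \<noteq> {}" "\<And>x. f x = (MAX i\<in>J. L i (proj 1 x) + b i)"
    using limit_of_Max_affine[OF I, of A X f c "\<lambda>i x. L i (proj 1 x)"] L(2) inactive by blast
  have "piecewise_linear_on (V 1) (\<lambda>z. MAX i\<in>J. L i z + b i)"
  proof (rule piecewise_linear_on_Max)
    show "finite J"
      using J(1) \<open>A \<subseteq> I\<close> I(1) finite_subset by (metis subset_trans)
  qed (use J L(1) step_pos in \<open>auto intro: subspace_layer\<close>)
  then show ?thesis
    using J(3) by blast
qed

end

section \<open>Horofunctions as blow-ups\<close>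

lemma (in Metric_space) ucc_closure_approx:
  assumes f: "f \<in> ucc_topology closure_of S" and K: "compactin mtopology K" and "0 < \<epsilon>"
  shows "\<exists>g\<in>S. \<forall>x\<in>K. \<bar>g x - f x\<bar> < \<epsilon>"
proof -
  \<comment> \<open>The uniform bound \<open>\<delta> < \<epsilon>\<close> leaves a margin at each
    \<open>g\<close>, half of which is the radius of a neighbourhood inside \<open>?U\<close>; hence
    \<open>?U\<close> is open.\<close>
  let ?U = "{g \<in> continuous_functions. \<exists>\<delta><\<epsilon>. \<forall>x\<in>K. \<bar>g x - f x\<bar> \<le> \<delta>}"
  have "f \<in> continuous_functions"
    using f unfolding in_closure_of topspace_def openin_ucc_topology ucc_open_def by blast
  then have "f \<in> ?U"
    using \<open>0 < \<epsilon>\<close> by auto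
  moreover have "openin ucc_topology ?U"
    unfolding openin_ucc_topology ucc_open_def
  proof (intro conjI ballI)
    fix g assume "g \<in> ?U"
    then obtain \<delta> where \<delta>: "\<delta> < \<epsilon>" "\<forall>x\<in>K. \<bar>g x - f x\<bar> \<le> \<delta>"
      by blast
    have "{h \<in> continuous_functions. \<forall>x\<in>K. \<bar>h x - g x\<bar> < (\<epsilon> - \<delta>) / 2} \<subseteq> ?U"
    proof clarify
      fix h assume h: "\<forall>x\<in>K. \<bar>h x - g x\<bar> < (\<epsilon> - \<delta>) / 2"
      have "\<bar>h x - f x\<bar> \<le> (\<epsilon> + \<delta>) / 2" if "x \<in> K" for x
      proof -
        have "\<bar>h x - f x\<bar> \<le> \<bar>h x - g x\<bar> + \<bar>g x - f x\<bar>"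
          by simp
        also have "\<dots> \<le> (\<epsilon> - \<delta>) / 2 + \<delta>"
          using bspec[OF h that] bspec[OF \<delta>(2) that] by (intro add_mono) auto
        finally show ?thesis
          by (simp add: field_simps)
      qed
      then show "\<exists>\<delta><\<epsilon>. \<forall>x\<in>K. \<bar>h x - f x\<bar> \<le> \<delta>"
        using \<delta>(1) by (intro exI[of _ "(\<epsilon> + \<delta>) / 2"]) auto
    qed
    then show "\<exists>K' \<epsilon>'. compactin mtopology K' \<and> 0 < \<epsilon>' \<and>
        {h \<in> continuous_functions. \<forall>x\<in>K'. \<bar>h x - g x\<bar> < \<epsilon>'} \<subseteq> ?U"
      using K \<delta>(1) by (intro exI[of _ K] exI[of _ "(\<epsilon> - \<delta>) / 2"]) auto
  qed auto
  moreover have "\<forall>T. f \<in> T \<and> openin ucc_topology T \<longrightarrow> (\<exists>g. g \<in> S \<and> g \<in> T)"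
    using f by (simp add: in_closure_of)
  ultimately obtain g where "g \<in> S \<and> g \<in> ?U"
    by (metis (no_types, lifting))
  then show ?thesis
    by force
qed

context layered_norm_group
begin

lemma in_carrier: "x \<in> carrier G"
  by (simp add: carrier_eq)

interpretation gmet: Metric_space "carrier G" gdist
  by (rule Metric_space_gdist)

lemma tendsto_gdist:
  assumes "(X \<longlongrightarrow> x) F" "(Y \<longlongrightarrow> y) F"
  shows "((\<lambda>n. gdist (X n) (Y n)) \<longlongrightarrow> gdist x y) F"
  unfolding gdist_eq inv_eq_uminus by (intro tendsto_nrm tendsto_mult_group tendsto_minus assms)

text \<open>The identity is continuous from the Euclidean to the metric topology, because
  \<open>gdist\<close> is continuous in Euclidean terms.\<close>

lemma compactin_gdist:
  assumes "compact K"
  shows "compactin gmet.mtopology K"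
proof -
  have "continuous_map euclidean gmet.mtopology id"
    unfolding gmet.continuous_map_to_metric
  proof (intro ballI allI impI)
    fix x :: 'a and r :: real assume "0 < r"
    have "continuous_on UNIV (gdist x)"
      by (auto simp: continuous_on_def intro!: tendsto_gdist)
    then have "open {y. gdist x y < r}"
      by (intro open_Collect_less continuous_intros)
    then show "\<exists>U. openin euclidean U \<and> x \<in> U \<and> (\<forall>y\<in>U. id y \<in> gmet.mball (id x) r)"
      using \<open>0 < r\<close> by (intro exI[of _ "{y. gdist x y < r}"]) (auto simp: in_carrier)
  qed
  from image_compactin[OF _ this] show ?thesis
    using assms by simp
qed

text \<open>\<open>X n\<close> is chosen to approximate \<open>f\<close> within
  \<open>1 / (n + 1)\<close> on the ball of radius \<open>n\<close>. The second property later
  forces \<open>X\<close> to leave every bounded set.\<close>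

lemma horofunction_limit:
  assumes "f \<in> gmet.horofunction_boundary \<one>"
  obtains X where "\<And>y. (\<lambda>n. gdist (X n) y - gdist (X n) \<one>) \<longlonglongrightarrow> f y"
    "\<And>x. f \<noteq> (\<lambda>y. gdist x y - gdist x \<one>)"
proof -
  have emb: "gmet.horo_embedding \<one> x = (\<lambda>y. gdist x y - gdist x \<one>)" for x
    unfolding gmet.horo_embedding_def by (simp add: carrier_eq restrict_def)
  have f: "f \<in> gmet.ucc_topology closure_of range (gmet.horo_embedding \<one>)"
    and not: "f \<notin> range (gmet.horo_embedding \<one>)"
    using assms unfolding gmet.horofunction_boundary_def by (auto simp: carrier_eq)
  have "\<exists>x. \<forall>y\<in>cball 0 (real n). \<bar>gdist x y - gdist x \<one> - f y\<bar> < 1 / real (Suc n)" for n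
    using gmet.ucc_closure_approx[OF f compactin_gdist[OF compact_cball], of "1 / real (Suc n)" 0 "real n"]
    by (auto simp: emb)
  then obtain X where X: "\<And>n y. y \<in> cball 0 (real n) \<Longrightarrow>
      \<bar>gdist (X n) y - gdist (X n) \<one> - f y\<bar> < 1 / real (Suc n)"
    by metis
  have "(\<lambda>n. gdist (X n) y - gdist (X n) \<one>) \<longlonglongrightarrow> f y" for y
  proof (rule LIM_zero_cancel, rule Lim_null_comparison)
    show "\<forall>\<^sub>F n in sequentially. norm (gdist (X n) y - gdist (X n) \<one> - f y) \<le> 1 / real (Suc n)"
      using eventually_ge_at_top[of "nat \<lceil>norm y\<rceil>"]
    proof eventually_elim
      case (elim n)
      then have "norm y \<le> real n"
        by linarith
      then show ?case
        using X[of y n] by simp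
    qed
    show "(\<lambda>n. 1 / real (Suc n)) \<longlonglongrightarrow> 0"
      using LIMSEQ_inverse_real_of_nat by (simp add: inverse_eq_divide)
  qed
  moreover have "f \<noteq> (\<lambda>y. gdist x y - gdist x \<one>)" for x
    using not emb[of x] by (metis rangeI)
  ultimately show ?thesis
    using that by blast
qed

lemma horofunction_piecewise_linear:
  assumes poly: "polysmooth s V N" and f: "f \<in> gmet.horofunction_boundary \<one>"
  shows "\<exists>g. piecewise_linear_on (V 1) g \<and> (\<forall>x. f x = g (proj 1 x))"
proof -
  obtain X where X: "\<And>y. (\<lambda>n. gdist (X n) y - gdist (X n) \<one>) \<longlonglongrightarrow> f y"
    and not: "\<And>x. f \<noteq> (\<lambda>y. gdist x y - gdist x \<one>)"
    using horofunction_limit[OF f] by blast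
  \<comment> \<open>Otherwise a subsequence of \<open>X\<close> converges to some \<open>x\<close>,
    and \<open>f\<close> would be the embedded point \<open>x\<close>.\<close>
  have "filterlim (\<lambda>n. nrm (X n)) at_top sequentially"
  proof (rule ccontr)
    assume "\<not> ?thesis"
    then obtain Z where "\<not> (\<forall>\<^sub>F n in sequentially. Z \<le> nrm (X n))"
      unfolding filterlim_at_top by blast
    from not_eventually_sequentiallyD[OF this] obtain r :: "nat \<Rightarrow> nat"
      where r: "strict_mono r" "\<And>n. nrm (X (r n)) \<le> Z"
      by (auto simp: not_le intro: less_imp_le)
    have "bounded (range (X \<circ> r))"
      using r(2) by (intro bounded_subset[OF bounded_nrm_le[of Z]]) auto
    then obtain x r' where r': "strict_mono r'" "((X \<circ> r) \<circ> r') \<longlonglongrightarrow> x"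
      using bounded_imp_convergent_subsequence by blast
    have "f y = gdist x y - gdist x \<one>" for y
    proof (rule LIMSEQ_unique)
      show "(\<lambda>n. gdist (X (r (r' n))) y - gdist (X (r (r' n))) \<one>) \<longlonglongrightarrow> f y"
        using LIMSEQ_subseq_LIMSEQ[OF X strict_mono_o[OF r(1) r'(1)]] by (simp add: o_def)
      show "(\<lambda>n. gdist (X (r (r' n))) y - gdist (X (r (r' n))) \<one>) \<longlonglongrightarrow> gdist x y - gdist x \<one>"
        using r'(2) by (intro tendsto_diff tendsto_gdist tendsto_const) (simp_all add: o_def)
    qed
    then show False
      using not by blast
  qed
  then have inf: "filterlim (\<lambda>n. nrm (inv (X n))) at_top sequentially"
    by (simp add: inv_eq_uminus nrm_uminus)
  then obtain m where m: "\<And>n. m \<le> n \<Longrightarrow> 0 < nrm (inv (X n))"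
    unfolding filterlim_at_top_dense eventually_sequentially by blast
  \<comment> \<open>The shift by \<open>m\<close> makes every \<open>nrm (Y n)\<close> positive, so
    that the rescaling is defined for all \<open>n\<close>.\<close>
  define Y where "Y n = inv (X (n + m))" for n
  have Y: "0 < nrm (Y n)" for n
    using m by (simp add: Y_def)
  have Y_inf: "filterlim (\<lambda>n. nrm (Y n)) at_top sequentially"
    unfolding Y_def using filterlim_compose[OF inf filterlim_add_const_nat_at_top] .
  define P where "P n = dilation s V (1 / nrm (Y n)) (Y n)" for n
  have P1: "nrm (P n) = 1" for n
    using Y[of n] by (simp add: P_def nrm_dilation)
  have "bounded (range P)"
    by (rule bounded_subset[OF bounded_nrm_le[of 1]]) (auto simp: P1)
  then obtain p r where r: "strict_mono r" "(P \<circ> r) \<longlonglongrightarrow> p"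
    using bounded_imp_convergent_subsequence by blast
  have "nrm p = 1"
    using tendsto_nrm[OF r(2)] LIMSEQ_unique[OF tendsto_const] by (fastforce simp: P1)
  moreover have "(\<lambda>n. 1 / nrm (Y (r n))) \<longlonglongrightarrow> 0"
    using filterlim_compose[OF Y_inf filterlim_subseq[OF r(1)]]
    by (intro tendsto_divide_0[OF tendsto_const] filterlim_at_top_imp_at_infinity)
  moreover have "(\<lambda>n. (nrm ((P \<circ> r) n \<otimes> dilation s V (1 / nrm (Y (r n))) y) - nrm ((P \<circ> r) n))
      / (1 / nrm (Y (r n)))) \<longlonglongrightarrow> f y" for y
  proof -
    \<comment> \<open>Both factors are dilated by \<open>1 / nrm (Y n)\<close>, so the product is
      the dilation of \<open>Y n \<otimes> y\<close>; homogeneity of \<open>nrm\<close> then turns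
      the blow-up quotient into the difference of distances.\<close>
    have "(nrm (P n \<otimes> dilation s V (1 / nrm (Y n)) y) - nrm (P n)) / (1 / nrm (Y n)) =
        gdist (X (n + m)) y - gdist (X (n + m)) \<one>" for n
    proof -
      have "nrm (P n \<otimes> dilation s V (1 / nrm (Y n)) y) = nrm (Y n \<otimes> y) / nrm (Y n)"
        using Y[of n] by (simp add: P_def nrm_dilation flip: dilation_mult)
      moreover have "gdist (X (n + m)) y = nrm (Y n \<otimes> y)" "gdist (X (n + m)) \<one> = nrm (Y n)"
        by (simp_all add: gdist_eq Y_def carrier_eq)
      ultimately show ?thesis
        using Y[of n] by (simp add: P1 field_simps)
    qed
    moreover have "(\<lambda>n. gdist (X (r n + m)) y - gdist (X (r n + m)) \<one>) \<longlonglongrightarrow> f y"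
      using filterlim_compose[OF X filterlim_compose[OF filterlim_add_const_nat_at_top filterlim_subseq[OF r(1)]]] .
    ultimately show ?thesis
      by simp
  qed
  ultimately show ?thesis
    using Y by (intro blow_up_limit[OF poly r(2)]) auto
qed

end

theorem theoremA:
  fixes G :: "'a::euclidean_space monoid"
    and bracket :: "'a \<Rightarrow> 'a \<Rightarrow> 'a"
    and s :: nat
    and V :: "nat \<Rightarrow> 'a set"
    and N :: "nat \<Rightarrow> 'a \<Rightarrow> real"
  assumes "stratified_group G bracket s V"
    and "layered_sup_norm G s V N"
    and "polysmooth s V N"
  shows "(\<forall>p f. layered_sup s V N p = 1 \<and> blow_up G s V (layered_sup s V N) p f \<longrightarrow>
            (\<exists>g. piecewise_linear_on (V 1) g \<and> (\<forall>x. f x = g (layer_proj s V 1 x)))) \<and>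
         (\<forall>f \<in> Metric_space.horofunction_boundary (carrier G)
                 (left_inv_dist G (layered_sup s V N)) \<one>\<^bsub>G\<^esub>.
            (\<exists>g. piecewise_linear_on (V 1) g \<and> (\<forall>x. f x = g (layer_proj s V 1 x))))"
proof -
  interpret stratified_group G bracket s V
    by fact
  interpret layered_norm_group G bracket s V N
    by unfold_locales fact
  show ?thesis
  proof (intro conjI allI impI ballI)
    fix p f assume "nrm p = 1 \<and> blow_up G s V nrm p f"
    then have p: "nrm p = 1" and blow_up: "blow_up G s V nrm p f"
      by auto
    obtain P \<epsilon> where P: "P \<longlonglongrightarrow> p \<and> \<epsilon> \<longlonglongrightarrow> 0 \<and> (\<forall>n. 0 < \<epsilon> n) \<and>
      locally_uniform_limit
        (\<lambda>n x. (nrm (P n \<otimes>\<^bsub>G\<^esub> dilation s V (\<epsilon> n) x) - nrm (P n)) / \<epsilon> n) f"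
      using blow_up unfolding blow_up_def by (elim exE)
    have "(\<lambda>n. (nrm (P n \<otimes>\<^bsub>G\<^esub> dilation s V (\<epsilon> n) x) - nrm (P n)) / \<epsilon> n) \<longlonglongrightarrow> f x" for x
    proof -
      have "\<exists>U. open U \<and> x \<in> U \<and> uniform_limit U
          (\<lambda>n x. (nrm (P n \<otimes>\<^bsub>G\<^esub> dilation s V (\<epsilon> n) x) - nrm (P n)) / \<epsilon> n) f sequentially"
        using P unfolding locally_uniform_limit_def by simp
      then show ?thesis
        by (elim exE conjE) (rule tendsto_uniform_limitI)
    qed
    then show "\<exists>g. piecewise_linear_on (V 1) g \<and> (\<forall>x. f x = g (proj 1 x))"
      using P p by (intro blow_up_limit[OF assms(3)]) auto
  qed (rule horofunction_piecewise_linear[OF assms(3)])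
qed

end
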